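(* For any integer $n\geqslant2$ one has $q(K)\geqslant n$ for every convex body $K$ in $\mathbb{R}^n$, and $$\sup\{q(K): K\text{ is a centrally symmetric convex body in }\mathbb{R}^n\}=+\infty .$$
   Context: A convex body in $\mathbb{R}^n$ is a compact convex set with non-empty interior; it is centrally symmetric if $x\in K$ implies $-x\in K$. $|\cdot|$ is volume, $S(K)$ is the surface area of $K$, $\sigma$ is the rotationally invariant probability measure on $S^{n-1}$, $h_K(y)=\max\{\langle x,y\rangle:x\in K\}$ is the support function, $w(K)=\int_{S^{n-1}}h_K(\xi)\,d\sigma(\xi)$ is the mean width (with this normalization), and $q(K)=\frac{w(K)S(K)}{|K|}$. *)

theory Defs
  imports "HOL-Probability.Probability"
begin

definition convex_body :: "(real^'n) set \<Rightarrow> bool" where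
  "convex_body K \<longleftrightarrow> compact K \<and> convex K \<and> interior K \<noteq> {}"

definition centrally_symmetric :: "(real^'n) set \<Rightarrow> bool" where
  "centrally_symmetric K \<longleftrightarrow> (\<forall>x\<in>K. - x \<in> K)"

(* The supremum is a maximum when K is compact and nonempty. *)
definition support_function :: "(real^'n) set \<Rightarrow> real^'n \<Rightarrow> real" where
  "support_function K y = (SUP x\<in>K. x \<bullet> y)"

(* The classical surface area of a convex body (outer Minkowski content):
   the limit of (|K + eps B| - |K|) / eps as eps decreases to 0, B the closed unit ball. *)
definition surface_area :: "(real^'n) set \<Rightarrow> real" where
  "surface_area K = Lim (at_right 0)
     (\<lambda>\<epsilon>. (measure lebesgue {x + y | x y. x \<in> K \<and> y \<in> cball 0 \<epsilon>} - measure lebesgue K) / \<epsilon>)"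

(* rotation_matrix is membership in SO(n).  In dimension at least 2 there is exactly one such
   measure on the Borel sets of the unit sphere (ex1_rotation_invariant_prob below), and it is
   also invariant under O(n).  In dimension 1 uniqueness fails and sphere_prob is unspecified. *)
definition rotation_invariant_prob :: "(real^'n) measure \<Rightarrow> bool" where
  "rotation_invariant_prob M \<longleftrightarrow>
     prob_space M \<and> sets M = sets (restrict_space borel (sphere 0 1)) \<and>
     (\<forall>Q::real^'n^'n. rotation_matrix Q \<longrightarrow> distr M M ((*v) Q) = M)"

definition sphere_prob :: "(real^'n) measure" where
  "sphere_prob = (THE M. rotation_invariant_prob M)"

(* Normalized as the average of the support function itself, without a factor 2. *)
definition mean_width :: "(real^'n) set \<Rightarrow> real" where
  "mean_width K = (\<integral>\<xi>. support_function K \<xi> \<partial>sphere_prob)"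

definition q_ratio :: "(real^'n) set \<Rightarrow> real" where
  "q_ratio K = mean_width K * surface_area K / measure lebesgue K"

lemma emeasure_lborel_orthogonal_uminus:
  fixes f :: "'a::euclidean_space \<Rightarrow> 'a"
  assumes f: "orthogonal_transformation f" and A[measurable]: "A \<in> sets borel"
  shows "emeasure lborel A = emeasure lborel ((\<lambda>y. - f y) -` A)"
proof -
  have lin: "linear f" using f by (simp add: orthogonal_transformation_linear)
  have [measurable]: "f \<in> borel_measurable borel"
    using lin by (simp add: borel_measurable_continuous_onI linear_continuous_on linear_conv_bounded_linear)
  have surj: "surj f" using f orthogonal_transformation_surj by blast
  have translate: "emeasure lborel ((\<lambda>y. f y + a) -` A) = emeasure lborel (f -` A)"
    if A[measurable]: "A \<in> sets borel" for A a
  proof -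
    obtain b where b: "a = f b" using surj by blast
    have [measurable]: "f -` A \<in> sets borel"
      by (rule measurable_sets_borel[of _ borel]) measurable
    have "(\<lambda>y. f y + a) -` A = (\<lambda>y. b + y) -` (f -` A)"
      using lin by (auto simp: b linear_add add.commute)
    also have "emeasure lborel \<dots> = emeasure (distr lborel borel ((+) b)) (f -` A)"
      by (subst emeasure_distr) auto
    finally show ?thesis by (simp add: lborel_distr_plus)
  qed
  define B :: "'a set" where "B = ball 0 1"
  have [measurable]: "B \<in> sets borel" by (simp add: B_def)
  have fB: "f -` B = B"
    using f by (auto simp: B_def orthogonal_transformation_norm)
  have Bpos: "emeasure lborel B \<noteq> 0" "emeasure lborel B \<noteq> \<infinity>"
    using content_ball_pos[of 1 "0::'a"] emeasure_bounded_finite[of "ball (0::'a) 1"]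
    by (auto simp: B_def measure_def)
    have "emeasure lborel A * emeasure lborel B
        = (\<integral>\<^sup>+x. indicator A x * emeasure lborel ((\<lambda>y. f y + x) -` B) \<partial>lborel)"
      by (subst translate) (auto simp: fB nn_integral_multc)
    also have "\<dots> = (\<integral>\<^sup>+x. (\<integral>\<^sup>+y. indicator A x * indicator B (f y + x) \<partial>lborel) \<partial>lborel)"
    proof (rule nn_integral_cong)
      fix x
      have [measurable]: "(\<lambda>y. f y + x) -` B \<in> sets borel"
        by (rule measurable_sets_borel[of _ borel]) measurable
      have "(\<integral>\<^sup>+y. indicator A x * indicator B (f y + x) \<partial>lborel)
        = indicator A x * (\<integral>\<^sup>+y. indicator ((\<lambda>y. f y + x) -` B) y \<partial>lborel)"
        by (subst nn_integral_cmult[symmetric]) (auto simp: indicator_def vimage_def)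
      then show "indicator A x * emeasure lborel ((\<lambda>y. f y + x) -` B) =
        (\<integral>\<^sup>+y. indicator A x * indicator B (f y + x) \<partial>lborel)"
        by simp
    qed
    also have "\<dots> = (\<integral>\<^sup>+y. (\<integral>\<^sup>+x. indicator A x * indicator B (f y + x) \<partial>lborel) \<partial>lborel)"
      by (rule lborel_pair.Fubini'[symmetric]) measurable
    also have "\<dots> = (\<integral>\<^sup>+y. (\<integral>\<^sup>+x. indicator A (- f y + x) * indicator B x \<partial>lborel) \<partial>lborel)"
    proof (rule nn_integral_cong)
      fix y
      have "(\<integral>\<^sup>+x. indicator A x * indicator B (f y + x) \<partial>lborel)
        = (\<integral>\<^sup>+x. indicator A x * indicator B (f y + x) \<partial>distr lborel borel ((+) (- f y)))"
        by (simp add: lborel_distr_plus)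
      also have "\<dots> = (\<integral>\<^sup>+x. indicator A (- f y + x) * indicator B x \<partial>lborel)"
        by (subst nn_integral_distr) auto
      finally show "(\<integral>\<^sup>+x. indicator A x * indicator B (f y + x) \<partial>lborel)
        = (\<integral>\<^sup>+x. indicator A (- f y + x) * indicator B x \<partial>lborel)" .
    qed
    also have "\<dots> = (\<integral>\<^sup>+x. (\<integral>\<^sup>+y. indicator A (- f y + x) * indicator B x \<partial>lborel) \<partial>lborel)"
      by (rule lborel_pair.Fubini') measurable
    also have "\<dots> = (\<integral>\<^sup>+x. emeasure lborel ((\<lambda>y. - f y) -` A) * indicator B x \<partial>lborel)"
    proof (rule nn_integral_cong)
      fix x
      have [measurable]: "(\<lambda>z. - z) -` A \<in> sets borel"
        by (rule measurable_sets_borel[of _ borel]) measurable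
      have [measurable]: "(\<lambda>y. - f y + x) -` A \<in> sets borel"
        by (rule measurable_sets_borel[of _ borel]) measurable
      have "(\<integral>\<^sup>+y. indicator A (- f y + x) * indicator B x \<partial>lborel)
        = (\<integral>\<^sup>+y. indicator ((\<lambda>y. - f y + x) -` A) y \<partial>lborel) * indicator B x"
        by (subst nn_integral_multc[symmetric]) (auto simp: indicator_def vimage_def)
      also have "\<dots> = emeasure lborel ((\<lambda>y. f y + (-x)) -` ((\<lambda>z. - z) -` A)) * indicator B x"
        by (simp add: vimage_def)
      also have "\<dots> = emeasure lborel ((\<lambda>y. - f y) -` A) * indicator B x"
        by (subst translate) (auto simp: vimage_def)
      finally show "(\<integral>\<^sup>+y. indicator A (- f y + x) * indicator B x \<partial>lborel)
        = emeasure lborel ((\<lambda>y. - f y) -` A) * indicator B x" .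
    qed
    also have "\<dots> = emeasure lborel ((\<lambda>y. - f y) -` A) * emeasure lborel B"
      by (simp add: nn_integral_cmult_indicator)
    finally show ?thesis
      using Bpos by (auto simp: mult.commute[of _ "emeasure lborel B"] ennreal_mult_cancel_left)
qed

lemma lborel_distr_orthogonal:
  fixes f :: "'a::euclidean_space \<Rightarrow> 'a"
  assumes f: "orthogonal_transformation f"
  shows "distr lborel borel f = lborel"
proof (rule measure_eqI)
  have [measurable]: "f \<in> borel_measurable borel"
    using f by (simp add: borel_measurable_continuous_onI linear_continuous_on
        linear_conv_bounded_linear[symmetric] orthogonal_transformation_linear)
  have neg: "orthogonal_transformation (\<lambda>x. - f x)"
    using f by (simp add: orthogonal_transformation_neg)
  fix A assume "A \<in> sets (distr lborel borel f)"
  then have [measurable]: "A \<in> sets borel" by simp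
  show "emeasure (distr lborel borel f) A = emeasure lborel A"
    using emeasure_lborel_orthogonal_uminus[OF neg, of A] by (simp add: emeasure_distr)
qed simp

lemma measure_le_of_uniform_balls:
  fixes M N :: "'a::euclidean_space measure"
  assumes M: "prob_space M" "sets M = sets borel" "emeasure M (- S) = 0"
    and N: "prob_space N" "sets N = sets borel" "emeasure N (- S) = 0"
    and S: "compact S"
    and bM: "\<And>r x y. x \<in> S \<Longrightarrow> y \<in> S \<Longrightarrow> emeasure M (ball x r) = emeasure M (ball y r)"
    and bN: "\<And>r x y. x \<in> S \<Longrightarrow> y \<in> S \<Longrightarrow> emeasure N (ball x r) = emeasure N (ball y r)"
    and F: "closed F"
  shows "emeasure M F \<le> emeasure N F"
proof -
  interpret M: prob_space M by fact
  interpret N: prob_space N by fact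
  interpret P: pair_sigma_finite M N ..
  note [measurable_cong] = M(2) N(2)
  have [measurable]: "F \<in> sets borel" "S \<in> sets borel"
    using F S by (auto simp: compact_imp_closed)
  have spM: "space M = UNIV" and spN: "space N = UNIV"
    using M(2) N(2) by (auto dest: sets_eq_imp_space_eq)
  have AEM: "AE x in M. x \<in> S"
    by (rule AE_I[of _ _ "- S"]) (use M in auto)
  have AEN: "AE x in N. x \<in> S"
    by (rule AE_I[of _ _ "- S"]) (use N in auto)
  have "S \<noteq> {}"
    using M(3) M.emeasure_space_1 by (auto simp: spM)
  then obtain e where e: "e \<in> S" by blast
  define c where "c r = emeasure N (ball e r)" for r
  define d where "d r = emeasure M (ball e r)" for r
  have c: "emeasure N (ball x r) = c r" if "x \<in> S" for x r
    using bN[OF that e] by (simp add: c_def)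
  have d: "emeasure M (ball x r) = d r" if "x \<in> S" for x r
    using bM[OF that e] by (simp add: d_def)
  have [measurable]: "ball x r \<in> sets borel" for x :: 'a and r by simp
  have Nball: "(\<integral>\<^sup>+y. indicator {y. dist x y < r} y \<partial>N) = emeasure N (ball x r)" for x r
    by (subst nn_integral_indicator) (auto simp: ball_def)
  have Mball: "(\<integral>\<^sup>+x. indicator {x. dist x y < r} x \<partial>M) = emeasure M (ball y r)" for y r
    by (subst nn_integral_indicator) (auto simp: ball_def dist_commute)
  have fub: "(\<integral>\<^sup>+x. (\<integral>\<^sup>+y. indicator A x * indicator {y. dist x y < r} y \<partial>N) \<partial>M)
     = (\<integral>\<^sup>+y. (\<integral>\<^sup>+x. indicator A x * indicator {x. dist x y < r} x \<partial>M) \<partial>N)"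
    if [measurable]: "A \<in> sets borel" for A r
  proof -
    have "(\<integral>\<^sup>+x. (\<integral>\<^sup>+y. indicator A x * indicator {y. dist x y < r} y \<partial>N) \<partial>M)
      = (\<integral>\<^sup>+y. (\<integral>\<^sup>+x. indicator A x * indicator {y. dist x y < r} y \<partial>M) \<partial>N)"
      by (rule P.Fubini'[symmetric]) measurable
    then show ?thesis by (simp add: indicator_def)
  qed
  have left: "(\<integral>\<^sup>+x. (\<integral>\<^sup>+y. indicator A x * indicator {y. dist x y < r} y \<partial>N) \<partial>M) = emeasure M A * c r"
    if [measurable]: "A \<in> sets borel" for A r
  proof -
    have "(\<integral>\<^sup>+x. (\<integral>\<^sup>+y. indicator A x * indicator {y. dist x y < r} y \<partial>N) \<partial>M)
      = (\<integral>\<^sup>+x. indicator A x * emeasure N (ball x r) \<partial>M)"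
      by (simp add: nn_integral_cmult Nball)
    also have "\<dots> = (\<integral>\<^sup>+x. indicator A x * c r \<partial>M)"
      by (rule nn_integral_cong_AE) (use AEM c in auto)
    finally show ?thesis by (simp add: nn_integral_multc)
  qed
  have right: "(\<integral>\<^sup>+y. (\<integral>\<^sup>+x. indicator UNIV x * indicator {x. dist x y < r} x \<partial>M) \<partial>N) = d r" for r
  proof -
    have "(\<integral>\<^sup>+y. (\<integral>\<^sup>+x. indicator UNIV x * indicator {x. dist x y < r} x \<partial>M) \<partial>N)
      = (\<integral>\<^sup>+y. emeasure M (ball y r) \<partial>N)"
      by (simp add: Mball)
    also have "\<dots> = (\<integral>\<^sup>+y. d r \<partial>N)"
      by (rule nn_integral_cong_AE) (use AEN d in auto)
    finally show ?thesis by (simp add: N.emeasure_space_1)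
  qed
  have cd: "c r = d r" for r
    using left[of UNIV r] fub[of UNIV r] right[of r] M.emeasure_space_1 by (simp add: spM)
  have cpos: "c r \<noteq> 0" if "r > 0" for r
  proof
    assume c0: "c r = 0"
    obtain D where D: "finite D" "D \<subseteq> S" "S \<subseteq> (\<Union>x\<in>D. ball x r)"
      using compactE_image[OF S, of S "\<lambda>x. ball x r"] \<open>r > 0\<close> by (metis UN_I centre_in_ball open_ball subsetI)
    have "emeasure N S \<le> emeasure N (\<Union>x\<in>D. ball x r)"
      using D by (intro emeasure_mono) auto
    also have "\<dots> \<le> (\<Sum>x\<in>D. emeasure N (ball x r))"
      using D by (intro emeasure_subadditive_finite) auto
    also have "\<dots> = 0"
      using D c c0 by (intro sum.neutral) auto
    finally have "emeasure N S = 0" by simp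
    moreover have "emeasure N S = 1"
      using N.emeasure_eq_1_AE[OF _ AEN] by auto
    ultimately show False by simp
  qed
  have [measurable]: "{y. infdist y F < r} \<in> sets borel" for r
    by (intro borel_open open_Collect_less continuous_intros)
  have thick: "emeasure M F \<le> emeasure N {y. infdist y F < r}" if "r > 0" "F \<noteq> {}" for r
  proof -
    have "emeasure M F * c r
        = (\<integral>\<^sup>+y. (\<integral>\<^sup>+x. indicator F x * indicator {x. dist x y < r} x \<partial>M) \<partial>N)"
      using left[of F r] fub[of F r] by simp
    also have "\<dots> \<le> (\<integral>\<^sup>+y. indicator {y. infdist y F < r} y * emeasure M (ball y r) \<partial>N)"
    proof (rule nn_integral_mono)
      fix y
      show "(\<integral>\<^sup>+x. indicator F x * indicator {x. dist x y < r} x \<partial>M)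
        \<le> indicator {y. infdist y F < r} y * emeasure M (ball y r)"
      proof (cases "infdist y F < r")
        case True
        have "(\<integral>\<^sup>+x. indicator F x * indicator {x. dist x y < r} x \<partial>M)
          \<le> (\<integral>\<^sup>+x. indicator {x. dist x y < r} x \<partial>M)"
          by (intro nn_integral_mono) (auto simp: indicator_def)
        then show ?thesis using True by (simp add: Mball)
      next
        case False
        then have "indicator F x * indicator {x. dist x y < r} x = (0::ennreal)" for x
          using infdist_le[of x F y] by (auto simp: indicator_def dist_commute)
        then have "(\<integral>\<^sup>+x. indicator F x * indicator {x. dist x y < r} x \<partial>M) = (\<integral>\<^sup>+x. 0 \<partial>M)"
          by (intro nn_integral_cong)
        then show ?thesis by simp
      qed
    qed
    also have "\<dots> = (\<integral>\<^sup>+y. indicator {y. infdist y F < r} y * c r \<partial>N)"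
      by (rule nn_integral_cong_AE) (use AEN d cd in auto)
    also have "\<dots> = emeasure N {y. infdist y F < r} * c r"
      by (simp add: nn_integral_multc)
    finally have "c r * emeasure M F \<le> c r * emeasure N {y. infdist y F < r}"
      by (simp add: mult.commute)
    moreover have "c r \<noteq> \<infinity>" by (simp add: c_def)
    ultimately show ?thesis
      using cpos[OF that(1)] by (simp add: ennreal_mult_le_mult_iff)
  qed
  show ?thesis
  proof (cases "F = {}")
    case False
    have Feq: "(\<Inter>n. {y. infdist y F < 1 / real (Suc n)}) = F"
    proof
      show "(\<Inter>n. {y. infdist y F < 1 / real (Suc n)}) \<subseteq> F"
      proof
        fix y assume y: "y \<in> (\<Inter>n. {y. infdist y F < 1 / real (Suc n)})"
        have "infdist y F \<le> 0"
          using y by (intro LIMSEQ_le_const[OF LIMSEQ_Suc[OF lim_1_over_n]]) (auto intro!: less_imp_le)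
        then show "y \<in> F"
          using F False infdist_nonneg[of y F] by (simp add: in_closed_iff_infdist_zero)
      qed
    qed auto
    have "(\<lambda>n. emeasure N {y. infdist y F < 1 / real (Suc n)})
        \<longlonglongrightarrow> emeasure N (\<Inter>n. {y. infdist y F < 1 / real (Suc n)})"
    proof (rule Lim_emeasure_decseq)
      show "decseq (\<lambda>n. {y. infdist y F < 1 / real (Suc n)})"
        unfolding decseq_def
      proof (intro allI impI subsetI, unfold mem_Collect_eq)
        fix m n :: nat and y :: 'a
        assume "m \<le> n" "infdist y F < 1 / real (Suc n)"
        moreover have "1 / real (Suc n) \<le> 1 / real (Suc m)"
          using \<open>m \<le> n\<close> by (intro divide_left_mono) auto
        ultimately show "infdist y F < 1 / real (Suc m)" by linarith
      qed
    qed auto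
    then show ?thesis
      unfolding Feq using thick False by (intro LIMSEQ_le_const) auto
  qed auto
qed

lemma rotation_invariant_prob_unique:
  fixes M N :: "(real^'n) measure"
  assumes n: "CARD('n) \<ge> 2" and M: "rotation_invariant_prob M" and N: "rotation_invariant_prob N"
  shows "M = N"
proof -
  let ?S = "sphere 0 1 :: (real^'n) set"
  have space: "space M = ?S" if "rotation_invariant_prob M" for M :: "(real^'n) measure"
    using that sets_eq_imp_space_eq[of M "restrict_space borel ?S"]
    by (auto simp: rotation_invariant_prob_def space_restrict_space)
  have id: "id \<in> measurable M borel" if "rotation_invariant_prob M" for M :: "(real^'n) measure"
    using that by (auto simp: rotation_invariant_prob_def id_def measurable_cong_sets[OF _ refl, of M "restrict_space borel ?S"]
        intro!: measurable_restrict_space1)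
  have ext: "emeasure (distr M borel id) A = emeasure M (A \<inter> ?S)"
    if "rotation_invariant_prob M" "A \<in> sets borel" for A and M :: "(real^'n) measure"
    using that id[OF that(1)] by (simp add: emeasure_distr space)
  have prob: "prob_space (distr M borel id)" if "rotation_invariant_prob M" for M :: "(real^'n) measure"
    using that id[OF that] by (auto simp: rotation_invariant_prob_def intro!: prob_space.prob_space_distr)
  have balls: "emeasure (distr M borel id) (ball x r) = emeasure (distr M borel id) (ball y r)"
    if inv: "rotation_invariant_prob M" and x: "x \<in> ?S" and y: "y \<in> ?S"
    for M :: "(real^'n) measure" and x y r
  proof -
    obtain f where f: "orthogonal_transformation f" "det (matrix f) = 1" "f x = y"
      using rotation_exists[OF n, of x y] x y by auto
    define Q where "Q = matrix f"
    have Qf: "(*v) Q = f"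
      using f(1) by (auto simp: Q_def orthogonal_transformation_linear matrix_works fun_eq_iff)
    have "rotation_matrix Q"
      using f by (simp add: rotation_matrix_def Q_def orthogonal_transformation_matrix)
    then have D: "distr M M f = M"
      using inv Qf by (auto simp: rotation_invariant_prob_def)
    have sM: "sets M = sets (restrict_space borel ?S)"
      using inv by (simp add: rotation_invariant_prob_def)
    have lf: "linear f" using f(1) by (simp add: orthogonal_transformation_linear)
    have "f \<in> borel_measurable borel"
      using lf by (simp add: borel_measurable_continuous_onI linear_continuous_on linear_conv_bounded_linear)
    then have "f \<in> measurable (restrict_space borel ?S) (restrict_space borel ?S)"
      using f(1) by (intro measurable_restrict_space3) (auto simp: orthogonal_transformation_norm)
    then have fM: "f \<in> measurable M M"
      using measurable_cong_sets[OF sM sM] by blast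
    have dist_f: "dist (f a) (f b) = dist a b" for a b
      using f(1) lf by (simp add: dist_norm linear_diff[symmetric] orthogonal_transformation_norm)
    have "ball y r \<inter> ?S \<in> sets M"
      unfolding sM sets_restrict_space by (auto simp: Int_commute)
    then have "emeasure M (ball y r \<inter> ?S) = emeasure M (f -` (ball y r \<inter> ?S) \<inter> ?S)"
      using emeasure_distr[OF fM, of "ball y r \<inter> ?S"] D space[OF inv] by simp
    also have "f -` (ball y r \<inter> ?S) \<inter> ?S = ball x r \<inter> ?S"
      using f(1) by (auto simp: f(3)[symmetric] dist_f orthogonal_transformation_norm)
    finally show ?thesis using inv by (simp add: ext)
  qed
  have compl: "emeasure (distr M borel id) (- ?S) = 0" if "rotation_invariant_prob M" for M :: "(real^'n) measure"
    using that by (subst ext) auto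
  have le: "emeasure (distr M borel id) F \<le> emeasure (distr N borel id) F"
    if "rotation_invariant_prob M" "rotation_invariant_prob N" "closed F" for F and M N :: "(real^'n) measure"
    by (rule measure_le_of_uniform_balls[OF prob[OF that(1)] sets_distr compl[OF that(1)]
          prob[OF that(2)] sets_distr compl[OF that(2)] compact_sphere
          balls[OF that(1)] balls[OF that(2)] that(3)])
  have eq: "distr M borel id = distr N borel id"
  proof (rule measure_eqI_generator_eq[where E="Collect closed" and \<Omega>=UNIV and A="\<lambda>_. UNIV"])
    show "Int_stable (Collect closed :: (real^'n) set set)"
      by (auto simp: Int_stable_def)
    show "emeasure (distr M borel id) X = emeasure (distr N borel id) X" if "X \<in> Collect closed" for X
      using le[OF M N, of X] le[OF N M, of X] that by (auto intro: antisym)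
    interpret M': prob_space "distr M borel id" by (rule prob[OF M])
    show "emeasure (distr M borel id) UNIV \<noteq> \<infinity>" for i :: nat by simp
  qed (auto simp: borel_eq_closed)
  show ?thesis
  proof (rule measure_eqI)
    show "sets M = sets N" using M N by (simp add: rotation_invariant_prob_def)
    fix A assume "A \<in> sets M"
    then obtain B where B: "B \<in> sets borel" "A = B \<inter> ?S"
      using M by (auto simp: rotation_invariant_prob_def sets_restrict_space)
    then show "emeasure M A = emeasure N A"
      using ext[OF M B(1)] ext[OF N B(1)] eq by simp
  qed
qed

lemma ex_rotation_invariant_prob:
  "\<exists>M::(real^'n) measure. rotation_invariant_prob M \<and>
     (\<forall>Q::real^'n^'n. orthogonal_matrix Q \<longrightarrow> distr M M ((*v) Q) = M)"
proof -
  let ?S = "sphere 0 1 :: (real^'n) set"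
  let ?R = "restrict_space borel ?S"
  define U where "U = uniform_measure lborel (ball 0 1 :: (real^'n) set)"
  define g :: "real^'n \<Rightarrow> real^'n" where "g x = (if x = 0 then axis undefined 1 else x /\<^sub>R norm x)" for x
  define M where "M = distr U ?R g"
  have vol: "emeasure lborel (ball 0 1 :: (real^'n) set) \<noteq> 0" "emeasure lborel (ball 0 1 :: (real^'n) set) \<noteq> \<infinity>"
    using content_ball_pos[of 1 "0::real^'n"] emeasure_bounded_finite[of "ball (0::real^'n) 1"]
    by (auto simp: measure_def)
  interpret U: prob_space U
    unfolding U_def by (rule prob_space_uniform_measure[OF vol])
  have gb: "g \<in> borel_measurable borel" unfolding g_def by measurable
  then have g: "g \<in> measurable U ?R"
    by (intro measurable_restrict_space2) (auto simp: U_def g_def)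
  have prob: "prob_space M" unfolding M_def by (rule U.prob_space_distr[OF g])
  have inv: "distr M M ((*v) Q) = M" if Q: "orthogonal_matrix Q" for Q :: "real^'n^'n"
  proof -
    define f where "f = (*v) Q"
    have f: "orthogonal_transformation f"
      using Q by (simp add: f_def orthogonal_transformation_matrix matrix_vector_mul_linear)
    have lf: "linear f" using f by (simp add: orthogonal_transformation_linear)
    have fb[measurable]: "f \<in> borel_measurable borel"
      using lf by (simp add: borel_measurable_continuous_onI linear_continuous_on linear_conv_bounded_linear)
    have fR: "f \<in> measurable ?R ?R"
      using f by (intro measurable_restrict_space3[OF fb]) (auto simp: orthogonal_transformation_norm)
    have fU: "f \<in> measurable U U" by (simp add: U_def)
    have dU: "distr U U f = U"
    proof (rule measure_eqI)
      fix A assume "A \<in> sets (distr U U f)"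
      then have A[measurable]: "A \<in> sets borel" by (simp add: U_def)
      have [measurable]: "f -` A \<in> sets borel"
        by (rule measurable_sets_borel[OF fb A])
      have "ball 0 1 \<inter> f -` A = f -` (ball 0 1 \<inter> A)"
        using f by (auto simp: orthogonal_transformation_norm)
      also have "emeasure lborel \<dots> = emeasure (distr lborel borel f) (ball 0 1 \<inter> A)"
        by (subst emeasure_distr) auto
      finally have "emeasure lborel (ball 0 1 \<inter> f -` A) = emeasure lborel (ball 0 1 \<inter> A)"
        by (simp add: lborel_distr_orthogonal[OF f])
      moreover have "emeasure (distr U U f) A = emeasure U (f -` A)"
        using fU by (subst emeasure_distr) (auto simp: U_def)
      ultimately show "emeasure (distr U U f) A = emeasure U A"
        by (simp add: U_def)
    qed simp
    have "AE x in lborel. x \<noteq> (0::real^'n)" by (rule AE_lborel_singleton)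
    then have "AE x in U. x \<noteq> 0"
      unfolding U_def by (intro AE_uniform_measureI) auto
    then have ae: "AE x in U. f (g x) = g (f x)"
    proof eventually_elim
      case (elim x)
      then have "f x \<noteq> 0" using f by (metis norm_eq_zero orthogonal_transformation_norm)
      then show ?case using elim f lf by (simp add: g_def linear_scale orthogonal_transformation_norm)
    qed
    have "distr M M f = distr M ?R f" by (rule distr_cong) (simp_all add: M_def)
    also have "\<dots> = distr U ?R (f \<circ> g)" unfolding M_def by (rule distr_distr[OF fR g])
    also have "\<dots> = distr U ?R (g \<circ> f)"
      by (rule distr_cong_AE) (use ae measurable_comp[OF g fR] measurable_comp[OF fU g] in auto)
    also have "\<dots> = distr (distr U U f) ?R g" by (rule distr_distr[OF g fU, symmetric])
    also have "\<dots> = M" by (simp only: dU M_def)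
    finally show ?thesis by (simp only: f_def)
  qed
  show ?thesis
    using prob inv by (intro exI[of _ M]) (auto simp: rotation_invariant_prob_def M_def rotation_matrix_def)
qed

lemma ex1_rotation_invariant_prob:
  assumes "CARD('n) \<ge> 2"
  shows "\<exists>!M::(real^'n) measure. rotation_invariant_prob M"
proof -
  obtain M :: "(real^'n) measure" where M: "rotation_invariant_prob M"
    using ex_rotation_invariant_prob by blast
  show ?thesis
  proof (rule ex1I)
    show "rotation_invariant_prob M" by fact
    show "N = M" if "rotation_invariant_prob N" for N :: "(real^'n) measure"
      by (rule rotation_invariant_prob_unique[OF assms that M])
  qed
qed

lemma sphere_prob_rotation_invariant:
  assumes "CARD('n) \<ge> 2"
  shows "rotation_invariant_prob (sphere_prob :: (real^'n) measure)"
  unfolding sphere_prob_def by (rule theI'[OF ex1_rotation_invariant_prob[OF assms]])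

lemma sphere_prob_orthogonal_invariant:
  assumes "CARD('n) \<ge> 2" and "orthogonal_matrix (Q::real^'n^'n)"
  shows "distr sphere_prob sphere_prob ((*v) Q) = sphere_prob"
proof -
  obtain M :: "(real^'n) measure" where M: "rotation_invariant_prob M"
      "\<forall>Q::real^'n^'n. orthogonal_matrix Q \<longrightarrow> distr M M ((*v) Q) = M"
    using ex_rotation_invariant_prob by blast
  have "sphere_prob = M"
    using rotation_invariant_prob_unique[OF assms(1) sphere_prob_rotation_invariant[OF assms(1)] M(1)] .
  then show ?thesis using M(2) assms(2) by simp
qed

end

theory Submission
  imports Defs
begin

text \<open>
For the lower bound, let \<open>B\<close> be the unit ball. Averaging Minkowski's first inequality
\<open>V(K, ..., K, g K) \<ge> |K|\<close> over all rotations \<open>g\<close> gives \<open>w(K) S(K) \<ge> n |K|\<close>, because the average of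
the support functions of the bodies \<open>g K\<close> is the constant \<open>w(K)\<close> on the unit sphere. The proof below
is a discrete version of this argument. A finite Minkowski average \<open>A\<close> of rotated copies of \<open>K\<close> can be made nearly round: it is contained in \<open>(w(K) + d) B\<close>
for any given \<open>d > 0\<close> (\<open>competitor_in_mean_width_ball\<close>), and by the Brunn-Minkowski inequality it has at
least the volume of \<open>K\<close>. Applying the Brunn-Minkowski inequality once more, to \<open>K\<close> and \<open>A\<close>, one finds
\<open>|K + e (w(K) + d) B| \<ge> (1 + e)^n |K|\<close> for a sequence of \<open>e\<close> tending to 0. The derivative at \<open>e = 0\<close> is
\<open>(w(K) + d) S(K) \<ge> n |K|\<close> (\<open>surface_area_ge_of_subset_ball\<close>).

The surface area is a limit, whose existence has to be shown: the function
\<open>e \<mapsto> ln |K + e B|\<close> is concave, again by the Brunn-Minkowski inequality, so its difference quotients at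
0 are monotone (\<open>tendsto_surface_area\<close>).

All uses of the Brunn-Minkowski inequality are for midpoints, in the multiplicative form
\<open>|A| |B| \<le> |(A + B) / 2|\<^sup>2\<close>. This is the case of indicator functions in the inequality of Prekopa and
Leindler (\<open>prekopa_leindler\<close>), which follows from dimension one by induction on the number of
coordinates. For midpoints no exponents other than 2 occur, so that the inequality makes sense for
functions with values in the extended nonnegative reals.

For the supremum, flatten the cube \<open>[-1, 1]^n\<close> in one direction to thickness \<open>2 d\<close>. Its volume tends to 0
with \<open>d\<close>, its two large faces keep the surface area at least \<open>2^n\<close>, and since \<open>n \<ge> 2\<close> it contains
a fixed segment in another direction, which bounds the mean width below
(\<open>ex_symmetric_convex_body_q_ratio_ge\<close>).
\<close>

section \<open>The one-dimensional Brunn-Minkowski inequality\<close>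

text \<open>Measure is approximated by initial segments that end at a point of the set itself: cut at an
increasing sequence in \<open>A\<close> that tends to the supremum, unless \<open>A\<close> has a maximum, which then
serves alone. The summand \<open>d\<close> lets this lemma and its mirror image be applied one after the other
without subtraction of extended numbers.\<close>

lemma emeasure_lborel_le_of_initial_segments:
  fixes A :: "real set" and c d :: ennreal
  assumes [measurable]: "A \<in> sets borel"
    and le: "\<And>a. a \<in> A \<Longrightarrow> emeasure lborel (A \<inter> {..a}) + d \<le> c"
    and "A \<noteq> {}"
  shows "emeasure lborel A + d \<le> c"
proof -
  obtain f where f: "incseq f" "range f \<subseteq> ereal ` A" "Sup (ereal ` A) = (SUP i. f i)"
    using Sup_countable_SUP[of "ereal ` A"] \<open>A \<noteq> {}\<close> by auto
  have "\<forall>i. \<exists>a\<in>A. f i = ereal a" using f(2) by blast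
  then obtain a where a: "\<And>i. a i \<in> A" "\<And>i. f i = ereal (a i)" by metis
  have inc: "incseq a" using f(1) by (simp add: incseq_def a)
  show ?thesis
  proof (cases "\<exists>m\<in>A. \<forall>x\<in>A. x \<le> m")
    case True
    then obtain m where m: "m \<in> A" "\<forall>x\<in>A. x \<le> m" by blast
    then have "A \<inter> {..m} = A" by auto
    then show ?thesis using le[OF m(1)] by simp
  next
    case no_max: False
    have U: "A = (\<Union>i. A \<inter> {..a i})"
    proof (intro equalityI subsetI)
      fix x assume x: "x \<in> A"
      then obtain y where y: "y \<in> A" "x < y" using no_max by (meson not_le)
      have "ereal x < Sup (ereal ` A)"
        using y by (meson Sup_upper image_eqI less_ereal.simps(1) less_le_trans)
      then obtain i where "ereal x < f i" unfolding f(3) by (auto simp: less_SUP_iff)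
      then show "x \<in> (\<Union>i. A \<inter> {..a i})" using x by (auto simp: a intro!: exI[of _ i])
    qed auto
    have "emeasure lborel (\<Union>i. A \<inter> {..a i}) = (SUP i. emeasure lborel (A \<inter> {..a i}))"
      using inc by (intro SUP_emeasure_incseq[symmetric]) (auto simp: incseq_def intro: order_trans)
    then have "emeasure lborel A = (SUP i. emeasure lborel (A \<inter> {..a i}))"
      using arg_cong[OF U, of "emeasure lborel"] by (rule trans[rotated])
    also have "(SUP i. emeasure lborel (A \<inter> {..a i})) + d = (SUP i. emeasure lborel (A \<inter> {..a i}) + d)"
      by (rule ennreal_SUP_add_left[symmetric]) simp
    also have "\<dots> \<le> c" using le a(1) by (intro SUP_least) auto
    finally show ?thesis .
  qed
qed

lemma emeasure_lborel_uminus: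
  fixes A :: "real set"
  assumes [measurable]: "A \<in> sets borel"
  shows "emeasure lborel (uminus -` A) = emeasure lborel A"
proof -
  have "emeasure lborel A = emeasure (distr lborel borel uminus) A"
    by (simp add: lborel_distr_uminus)
  then show ?thesis by (simp add: emeasure_distr)
qed

lemma emeasure_lborel_le_of_final_segments:
  fixes A :: "real set" and c d :: ennreal
  assumes [measurable]: "A \<in> sets borel"
    and le: "\<And>a. a \<in> A \<Longrightarrow> emeasure lborel (A \<inter> {a..}) + d \<le> c"
    and "A \<noteq> {}"
  shows "emeasure lborel A + d \<le> c"
proof -
  have m: "uminus -` A \<in> sets borel"
    by (rule measurable_sets_borel[of _ borel]) auto
  have "emeasure lborel (uminus -` A) + d \<le> c"
  proof (rule emeasure_lborel_le_of_initial_segments[OF m])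
    fix a assume a: "a \<in> uminus -` A"
    have eq: "uminus -` A \<inter> {..a} = uminus -` (A \<inter> {-a..})" by auto
    show "emeasure lborel (uminus -` A \<inter> {..a}) + d \<le> c"
      unfolding eq using le[of "-a"] a by (subst emeasure_lborel_uminus) auto
  next
    from \<open>A \<noteq> {}\<close> obtain a where "a \<in> A" by blast
    then have "- a \<in> uminus -` A" by simp
    then show "uminus -` A \<noteq> {}" by blast
  qed
  then show ?thesis by (simp add: emeasure_lborel_uminus)
qed

lemma emeasure_lborel_vimage_midpoint:
  fixes A :: "real set"
  assumes [measurable]: "A \<in> sets borel"
  shows "2 * emeasure lborel ((\<lambda>z. 2 * z - b) -` A) = emeasure lborel A"
proof -
  have [measurable]: "(\<lambda>z::real. 2 * z - b) -` A \<in> sets borel"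
    by (rule measurable_sets_borel[of _ borel]) measurable
  have "emeasure lborel A = (\<integral>\<^sup>+x. indicator A x \<partial>lborel)" by simp
  also have "\<dots> = 2 * (\<integral>\<^sup>+x. indicator A (-b + 2 * x) \<partial>lborel)"
    by (subst nn_integral_real_affine[of _ 2 "-b"]) auto
  also have "(\<integral>\<^sup>+x. indicator A (-b + 2 * x) \<partial>lborel) =
      (\<integral>\<^sup>+x. indicator ((\<lambda>z. 2 * z - b) -` A) x \<partial>lborel)"
    by (intro nn_integral_cong) (auto simp: indicator_def)
  finally show ?thesis by simp
qed

text \<open>For \<open>a \<in> A\<close> and \<open>b \<in> B\<close>, halve both sets and slide one along the other: the part of \<open>A\<close> to the
left of \<open>a\<close>, averaged with \<open>b\<close>, and the part of \<open>B\<close> to the right of \<open>b\<close>, averaged with \<open>a\<close>,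
lie in \<open>C\<close> on the two sides of \<open>(a + b) / 2\<close> and so share only that point.\<close>

lemma brunn_minkowski_line:
  fixes A B C :: "real set"
  assumes [measurable]: "A \<in> sets borel" "B \<in> sets borel" "C \<in> sets borel"
    and ne: "A \<noteq> {}" "B \<noteq> {}"
    and sub: "\<And>x y. x \<in> A \<Longrightarrow> y \<in> B \<Longrightarrow> (x + y) / 2 \<in> C"
  shows "emeasure lborel A + emeasure lborel B \<le> 2 * emeasure lborel C"
proof -
  have key: "emeasure lborel (A \<inter> {..a}) + emeasure lborel (B \<inter> {b..}) \<le> 2 * emeasure lborel C"
    if a: "a \<in> A" and b: "b \<in> B" for a b
  proof -
    define P where "P = (\<lambda>z. 2 * z - b) -` (A \<inter> {..a})"
    define Q where "Q = (\<lambda>z. 2 * z - a) -` (B \<inter> {b..})"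
    have [measurable]: "P \<in> sets borel" "Q \<in> sets borel"
      unfolding P_def Q_def by (rule measurable_sets_borel[of _ borel]; measurable)+
    have "P \<inter> Q \<subseteq> {(a + b) / 2}" by (auto simp: P_def Q_def)
    then have "emeasure lborel (P \<inter> Q) \<le> emeasure lborel {(a + b) / 2}"
      by (intro emeasure_mono) auto
    then have null: "emeasure lborel (P \<inter> Q) = 0" by simp
    have PC: "z \<in> C" if "z \<in> P" for z using sub[of "2 * z - b" b] b that by (simp add: P_def)
    have QC: "z \<in> C" if "z \<in> Q" for z using sub[of a "2 * z - a"] a that by (simp add: Q_def)
    have "emeasure lborel P + emeasure lborel Q = emeasure lborel (P \<union> Q) + emeasure lborel (P \<inter> Q)"
      by (rule emeasure_Un_Int) auto
    also have "\<dots> \<le> emeasure lborel C"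
      unfolding null using PC QC by (auto intro!: emeasure_mono)
    finally have "2 * (emeasure lborel P + emeasure lborel Q) \<le> 2 * emeasure lborel C"
      by (intro mult_left_mono) auto
    then show ?thesis
      unfolding P_def Q_def distrib_left
      by (subst (asm) (1 2) emeasure_lborel_vimage_midpoint) auto
  qed
  have *: "emeasure lborel A + emeasure lborel (B \<inter> {b..}) \<le> 2 * emeasure lborel C" if "b \<in> B" for b
    by (rule emeasure_lborel_le_of_initial_segments) (use ne key that in auto)
  have "emeasure lborel B + emeasure lborel A \<le> 2 * emeasure lborel C"
    by (rule emeasure_lborel_le_of_final_segments) (use ne * in \<open>auto simp: add.commute\<close>)
  then show ?thesis by (simp add: add.commute)
qed

section \<open>The Prekopa-Leindler and Brunn-Minkowski inequalities for midpoints\<close>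

text \<open>Cavalieri's principle. Levels can be cut off at 1 since \<open>f\<close> does not exceed 1.\<close>

lemma (in sigma_finite_measure) nn_integral_layer_cake_unit:
  assumes [measurable]: "f \<in> borel_measurable M" and le: "\<And>x. f x \<le> 1"
  shows "(\<integral>\<^sup>+x. f x \<partial>M) =
    (\<integral>\<^sup>+s. indicator {0<..<1::real} s * emeasure M {x \<in> space M. ennreal s < f x} \<partial>lborel)"
proof -
  interpret P: pair_sigma_finite M "lborel :: real measure" ..
  have v: "(\<integral>\<^sup>+s. indicator {0<..<1::real} s * indicator {s. ennreal s < v} s \<partial>lborel) = v"
    if v1: "v \<le> 1" for v
  proof -
    obtain r where r: "v = ennreal r" "0 \<le> r" using v1 by (cases v) (auto simp: top_unique)
    then have "r \<le> 1" using v1 by simp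
    have "(\<integral>\<^sup>+s. indicator {0<..<1::real} s * indicator {s. ennreal s < v} s \<partial>lborel)
        = (\<integral>\<^sup>+s. indicator {0<..<r} s \<partial>lborel)"
      using r \<open>r \<le> 1\<close> by (intro nn_integral_cong) (auto simp: indicator_def ennreal_less_iff)
    then show ?thesis using r by simp
  qed
  have "(\<integral>\<^sup>+x. f x \<partial>M) =
      (\<integral>\<^sup>+x. \<integral>\<^sup>+s. indicator {0<..<1::real} s * indicator {s. ennreal s < f x} s \<partial>lborel \<partial>M)"
    by (simp add: v le)
  also have "\<dots> = (\<integral>\<^sup>+s. \<integral>\<^sup>+x. indicator {0<..<1::real} s * indicator {s. ennreal s < f x} s \<partial>M \<partial>lborel)"
    by (rule P.Fubini'[symmetric]) measurable
  also have "\<dots> = (\<integral>\<^sup>+s. indicator {0<..<1::real} s * emeasure M {x \<in> space M. ennreal s < f x} \<partial>lborel)"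
  proof (rule nn_integral_cong)
    fix s :: real
    have "(\<integral>\<^sup>+x. indicator {0<..<1::real} s * indicator {s. ennreal s < f x} s \<partial>M)
        = (\<integral>\<^sup>+x. indicator {0<..<1::real} s * indicator {x \<in> space M. ennreal s < f x} x \<partial>M)"
      by (intro nn_integral_cong) (auto simp: indicator_def)
    also have "\<dots> = indicator {0<..<1::real} s * emeasure M {x \<in> space M. ennreal s < f x}"
      by (subst nn_integral_cmult) auto
    finally show "(\<integral>\<^sup>+x. indicator {0<..<1::real} s * indicator {s. ennreal s < f x} s \<partial>M) = \<dots>" .
  qed
  finally show ?thesis .
qed

text \<open>Once both suprema equal 1, the superlevel sets of \<open>f\<close> and of \<open>g\<close> at every level below 1 are nonempty,
and their midpoints lie in the superlevel set of \<open>h\<close> at the same level. The one-dimensional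
Brunn-Minkowski inequality therefore holds level by level, and it can be integrated over the levels.
The common normalization is essential: empty superlevel sets would break this.\<close>

lemma prekopa_leindler_line_normalized:
  fixes f g h :: "real \<Rightarrow> ennreal"
  assumes [measurable]: "f \<in> borel_measurable borel" "g \<in> borel_measurable borel" "h \<in> borel_measurable borel"
    and mid: "\<And>x y. f x * g y \<le> (h ((x + y) / 2))\<^sup>2"
    and sup: "(SUP x. f x) = 1" "(SUP x. g x) = 1"
  shows "(\<integral>\<^sup>+x. f x \<partial>lborel) + (\<integral>\<^sup>+x. g x \<partial>lborel) \<le> 2 * (\<integral>\<^sup>+x. h x \<partial>lborel)"
proof -
  have f1: "f x \<le> 1" and g1: "g x \<le> 1" for x
    using SUP_upper[of x UNIV f] SUP_upper[of x UNIV g] by (auto simp: sup)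
  have "(\<integral>\<^sup>+x. f x \<partial>lborel) + (\<integral>\<^sup>+x. g x \<partial>lborel)
     = (\<integral>\<^sup>+s. indicator {0<..<1::real} s * (emeasure lborel {x. ennreal s < f x}
          + emeasure lborel {x. ennreal s < g x}) \<partial>lborel)"
    by (subst (1 2) lborel.nn_integral_layer_cake_unit)
       (auto simp: f1 g1 distrib_left nn_integral_add)
  also have "\<dots> \<le> (\<integral>\<^sup>+s. 2 * (indicator {0<..<1::real} s * emeasure lborel {x. ennreal s < min (h x) 1}) \<partial>lborel)"
  proof (rule nn_integral_mono)
    fix s :: real
    have "emeasure lborel {x. ennreal s < f x} + emeasure lborel {x. ennreal s < g x}
        \<le> 2 * emeasure lborel {x. ennreal s < min (h x) 1}" if s: "0 < s" "s < 1"
    proof (rule brunn_minkowski_line)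
      have s1: "ennreal s < 1" using s by (simp add: ennreal_less_one_iff)
      then show "{x. ennreal s < f x} \<noteq> {}" "{x. ennreal s < g x} \<noteq> {}"
        using less_SUP_iff[of "ennreal s" f UNIV] less_SUP_iff[of "ennreal s" g UNIV] sup by auto
      fix x y assume xy: "x \<in> {x. ennreal s < f x}" "y \<in> {x. ennreal s < g x}"
      obtain u where u: "f x = ennreal u" "0 \<le> u" using f1[of x] by (cases "f x") (auto simp: top_unique)
      obtain v where v: "g y = ennreal v" "0 \<le> v" using g1[of y] by (cases "g y") (auto simp: top_unique)
      have uv: "s < u" "s < v" using xy u v s by (auto simp: ennreal_less_iff)
      have "ennreal s < h ((x + y) / 2)"
      proof (rule ccontr)
        assume "\<not> ?thesis"
        then have "(h ((x + y) / 2))\<^sup>2 \<le> (ennreal s)\<^sup>2" by (intro power_mono) auto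
        then have "ennreal (u * v) \<le> ennreal (s * s)"
          using mid[of x y] u v s by (auto simp: ennreal_mult power2_eq_square)
        then have "u * v \<le> s * s" using s by simp
        moreover have "s * s < u * v" using uv s by (intro mult_strict_mono) auto
        ultimately show False by simp
      qed
      then show "(x + y) / 2 \<in> {x. ennreal s < min (h x) 1}" using s1 by simp
    qed measurable
    then show "indicator {0<..<1::real} s * (emeasure lborel {x. ennreal s < f x}
          + emeasure lborel {x. ennreal s < g x})
      \<le> 2 * (indicator {0<..<1::real} s * emeasure lborel {x. ennreal s < min (h x) 1})"
      by (auto simp: indicator_def)
  qed
  also have "\<dots> = 2 * (\<integral>\<^sup>+x. min (h x) 1 \<partial>lborel)"
    by (subst (2) lborel.nn_integral_layer_cake_unit) (auto simp: nn_integral_cmult)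
  also have "\<dots> \<le> 2 * (\<integral>\<^sup>+x. h x \<partial>lborel)"
    by (intro mult_left_mono nn_integral_mono) auto
  finally show ?thesis .
qed

text \<open>Scaling \<open>f\<close>, \<open>g\<close> and \<open>h\<close> by \<open>1 / a\<close>, \<open>1 / b\<close> and \<open>1 / sqrt (a b)\<close> preserves the hypothesis and
achieves the normalization; the additive conclusion turns into a multiplicative one by
the inequality of the arithmetic and the geometric mean.\<close>

lemma prekopa_leindler_line_bounded:
  fixes f g h :: "real \<Rightarrow> ennreal"
  assumes [measurable]: "f \<in> borel_measurable borel" "g \<in> borel_measurable borel" "h \<in> borel_measurable borel"
    and mid: "\<And>x y. f x * g y \<le> (h ((x + y) / 2))\<^sup>2"
    and bounded: "(SUP x. f x) < \<infinity>" "(SUP x. g x) < \<infinity>"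
  shows "(\<integral>\<^sup>+x. f x \<partial>lborel) * (\<integral>\<^sup>+x. g x \<partial>lborel) \<le> (\<integral>\<^sup>+x. h x \<partial>lborel)\<^sup>2"
proof -
  let ?F = "\<integral>\<^sup>+x. f x \<partial>lborel" and ?G = "\<integral>\<^sup>+x. g x \<partial>lborel" and ?H = "\<integral>\<^sup>+x. h x \<partial>lborel"
  obtain a where a: "(SUP x. f x) = ennreal a" "0 \<le> a"
    using bounded by (cases "SUP x. f x") auto
  obtain b where b: "(SUP x. g x) = ennreal b" "0 \<le> b"
    using bounded by (cases "SUP x. g x") auto
  consider "a = 0" | "b = 0" | "?H = \<infinity>" | "a > 0" "b > 0" "?H < \<infinity>"
    using a b by (metis infinity_ennreal_def less_top order_le_less)
  then show ?thesis
  proof cases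
    case 1
    then have "f x = 0" for x using SUP_upper[of x UNIV f] a by simp
    then show ?thesis by simp
  next
    case 2
    then have "g x = 0" for x using SUP_upper[of x UNIV g] b by simp
    then show ?thesis by simp
  next
    case 3
    then show ?thesis by (simp add: power2_eq_square ennreal_mult_top)
  next
    case 4
    define c where "c = sqrt (a * b)"
    have c: "c > 0" "c * c = a * b" using 4 by (auto simp: c_def)
    have "(\<integral>\<^sup>+x. ennreal (1/a) * f x \<partial>lborel) + (\<integral>\<^sup>+x. ennreal (1/b) * g x \<partial>lborel)
      \<le> 2 * (\<integral>\<^sup>+x. ennreal (1/c) * h x \<partial>lborel)"
    proof (rule prekopa_leindler_line_normalized)
      fix x y
      have "ennreal (1/a) * f x * (ennreal (1/b) * g y) = ennreal (1/a) * ennreal (1/b) * (f x * g y)"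
        by (simp add: ac_simps)
      also have "\<dots> \<le> ennreal (1/a) * ennreal (1/b) * (h ((x + y) / 2))\<^sup>2"
        by (intro mult_left_mono mid) simp
      also have "ennreal (1/a) * ennreal (1/b) = ennreal (1/c) * ennreal (1/c)"
        using 4 c by (simp flip: ennreal_mult)
      finally show "ennreal (1/a) * f x * (ennreal (1/b) * g y) \<le> (ennreal (1/c) * h ((x + y) / 2))\<^sup>2"
        by (simp add: power2_eq_square ac_simps)
    next
      show "(SUP x. ennreal (1/a) * f x) = 1" "(SUP x. ennreal (1/b) * g x) = 1"
        using 4 a b by (auto simp flip: SUP_mult_left_ennreal ennreal_mult)
    qed measurable
    then have "ennreal (1/a) * ?F + ennreal (1/b) * ?G \<le> 2 * (ennreal (1/c) * ?H)"
      by (simp add: nn_integral_cmult)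
    moreover obtain H where H: "?H = ennreal H" "0 \<le> H" using 4 by (cases ?H) auto
    ultimately have le: "ennreal (1/a) * ?F + ennreal (1/b) * ?G \<le> ennreal (2 * (H / c))"
      using c ennreal_mult[of 2 "H / c"] by (simp flip: ennreal_mult)
    then have fin: "?F \<noteq> \<infinity>" "?G \<noteq> \<infinity>" using 4 by (auto simp: ennreal_mult_top top_unique)
    obtain F where F: "?F = ennreal F" "0 \<le> F" using fin by (cases ?F) auto
    obtain G where G: "?G = ennreal G" "0 \<le> G" using fin by (cases ?G) auto
    have "F / a + G / b \<le> 2 * (H / c)"
      using le F G H 4 c by (simp flip: ennreal_mult ennreal_plus)
    moreover have "4 * ((F / a) * (G / b)) \<le> (F / a + G / b)\<^sup>2"
      using sum_squares_bound[of "F / a" "G / b"] by (simp add: power2_sum)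
    moreover have "(F / a + G / b)\<^sup>2 \<le> (2 * (H / c))\<^sup>2"
      using calculation(1) F G 4 by (intro power_mono) auto
    ultimately have "F * G / (a * b) \<le> H\<^sup>2 / (c * c)"
      by (simp add: power2_eq_square)
    then have "F * G \<le> H\<^sup>2" using c 4 by (simp add: divide_le_cancel)
    then show ?thesis using F G H by (simp add: ennreal_power flip: ennreal_mult)
  qed
qed

lemma nn_integral_truncate:
  assumes [measurable]: "f \<in> borel_measurable M"
  shows "(\<integral>\<^sup>+x. f x \<partial>M) = (SUP n. \<integral>\<^sup>+x. min (f x) (of_nat n) \<partial>M)"
proof -
  have "(SUP n. min (f x) (of_nat n)) = f x" for x
    using inf_SUP[of "f x" of_nat "UNIV :: nat set"] by (simp add: ennreal_SUP_of_nat_eq_top inf_min)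
  then have "(\<integral>\<^sup>+x. f x \<partial>M) = (\<integral>\<^sup>+x. (SUP n. min (f x) (of_nat n)) \<partial>M)" by simp
  also have "\<dots> = (SUP n. \<integral>\<^sup>+x. min (f x) (of_nat n) \<partial>M)"
    by (rule nn_integral_monotone_convergence_SUP)
       (auto simp: incseq_def le_fun_def min.coboundedI2)
  finally show ?thesis .
qed

lemma prekopa_leindler_line:
  fixes f g h :: "real \<Rightarrow> ennreal"
  assumes [measurable]: "f \<in> borel_measurable borel" "g \<in> borel_measurable borel" "h \<in> borel_measurable borel"
    and mid: "\<And>x y. f x * g y \<le> (h ((x + y) / 2))\<^sup>2"
  shows "(\<integral>\<^sup>+x. f x \<partial>lborel) * (\<integral>\<^sup>+x. g x \<partial>lborel) \<le> (\<integral>\<^sup>+x. h x \<partial>lborel)\<^sup>2"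
proof -
  have le: "(\<integral>\<^sup>+x. min (f x) (of_nat m) \<partial>lborel) * (\<integral>\<^sup>+x. min (g x) (of_nat n) \<partial>lborel)
      \<le> (\<integral>\<^sup>+x. h x \<partial>lborel)\<^sup>2" for m n
  proof (rule prekopa_leindler_line_bounded)
    show "min (f x) (of_nat m) * min (g y) (of_nat n) \<le> (h ((x + y) / 2))\<^sup>2" for x y
      by (rule order_trans[OF mult_mono mid]) auto
    have "(SUP x. min (f x) (of_nat m)) \<le> of_nat m" "(SUP x. min (g x) (of_nat n)) \<le> of_nat n"
      by (auto intro!: SUP_least)
    then show "(SUP x. min (f x) (of_nat m)) < \<infinity>" "(SUP x. min (g x) (of_nat n)) < \<infinity>"
      by (auto elim!: order.strict_trans1 simp: of_nat_less_top)
  qed measurable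
  have f: "(\<integral>\<^sup>+x. f x \<partial>lborel) = (SUP n. \<integral>\<^sup>+x. min (f x) (of_nat n) \<partial>lborel)"
    and g: "(\<integral>\<^sup>+x. g x \<partial>lborel) = (SUP n. \<integral>\<^sup>+x. min (g x) (of_nat n) \<partial>lborel)"
    by (rule nn_integral_truncate, simp)+
  show ?thesis
    unfolding f g by (auto simp: SUP_mult_left_ennreal SUP_mult_right_ennreal intro!: SUP_least le)
qed

text \<open>Integrating out one coordinate turns three functions as in the hypothesis into three functions of the
remaining coordinates of the same kind; this is the one-dimensional case. The multiplicative
form is what makes the induction work. The points range over \<open>extensional I\<close> because that is the
space of the product measure.\<close>

lemma prekopa_leindler_PiM:
  fixes f g h :: "('i \<Rightarrow> real) \<Rightarrow> ennreal"
  assumes "finite I"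
    and "f \<in> borel_measurable (\<Pi>\<^sub>M i\<in>I. lborel)" "g \<in> borel_measurable (\<Pi>\<^sub>M i\<in>I. lborel)"
      "h \<in> borel_measurable (\<Pi>\<^sub>M i\<in>I. lborel)"
    and "\<And>x y. x \<in> extensional I \<Longrightarrow> y \<in> extensional I \<Longrightarrow> f x * g y \<le> (h (\<lambda>i\<in>I. (x i + y i) / 2))\<^sup>2"
  shows "(\<integral>\<^sup>+x. f x \<partial>(\<Pi>\<^sub>M i\<in>I. lborel)) * (\<integral>\<^sup>+x. g x \<partial>(\<Pi>\<^sub>M i\<in>I. lborel))
    \<le> (\<integral>\<^sup>+x. h x \<partial>(\<Pi>\<^sub>M i\<in>I. lborel))\<^sup>2"
  using assms
proof (induction I arbitrary: f g h rule: finite_induct)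
  case empty
  interpret product_sigma_finite "\<lambda>_::'i. lborel :: real measure" by standard
  show ?case
    using empty.prems(4)[of "\<lambda>_. undefined" "\<lambda>_. undefined"]
    by (simp add: nn_integral_empty restrict_def)
next
  case (insert i I)
  interpret product_sigma_finite "\<lambda>_::'i. lborel :: real measure" by standard
  note [measurable] = insert.prems(1-3)
  have upd: "(\<lambda>s. F (x(i := s))) \<in> borel_measurable borel"
    if "F \<in> borel_measurable (\<Pi>\<^sub>M i\<in>insert i I. lborel)" and x: "x \<in> extensional I"
    for F :: "('i \<Rightarrow> real) \<Rightarrow> ennreal" and x
  proof -
    have "(\<lambda>s. x(i := s)) \<in> measurable lborel (\<Pi>\<^sub>M i\<in>insert i I. lborel)"
      using measurable_compose[OF measurable_Pair1' measurable_add_dim, of x I "\<lambda>_. lborel" i] x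
      by (simp add: space_PiM PiE_def)
    from measurable_compose[OF this that(1)] show ?thesis by simp
  qed
  have ext: "x(i := s) \<in> extensional (insert i I)" if "x \<in> extensional I" for x :: "'i \<Rightarrow> real" and s
    using that by (auto simp: extensional_def)
  have mid: "(\<lambda>j\<in>insert i I. ((x(i := s)) j + (y(i := t)) j) / 2) = (\<lambda>j\<in>I. (x j + y j) / 2)(i := (s + t) / 2)"
    for x y :: "'i \<Rightarrow> real" and s t
    using insert.hyps by (auto simp: fun_eq_iff)
  have "(\<integral>\<^sup>+x. (\<integral>\<^sup>+s. f (x(i := s)) \<partial>lborel) \<partial>(\<Pi>\<^sub>M i\<in>I. lborel))
      * (\<integral>\<^sup>+x. (\<integral>\<^sup>+s. g (x(i := s)) \<partial>lborel) \<partial>(\<Pi>\<^sub>M i\<in>I. lborel))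
    \<le> (\<integral>\<^sup>+x. (\<integral>\<^sup>+s. h (x(i := s)) \<partial>lborel) \<partial>(\<Pi>\<^sub>M i\<in>I. lborel))\<^sup>2"
  proof (rule insert.IH)
    fix x y :: "'i \<Rightarrow> real" assume xy: "x \<in> extensional I" "y \<in> extensional I"
    show "(\<integral>\<^sup>+s. f (x(i := s)) \<partial>lborel) * (\<integral>\<^sup>+s. g (y(i := s)) \<partial>lborel)
      \<le> (\<integral>\<^sup>+s. h ((\<lambda>i\<in>I. (x i + y i) / 2)(i := s)) \<partial>lborel)\<^sup>2"
    proof (rule prekopa_leindler_line)
      show "f (x(i := s)) * g (y(i := t)) \<le> (h ((\<lambda>i\<in>I. (x i + y i) / 2)(i := (s + t) / 2)))\<^sup>2" for s t
        using insert.prems(4)[OF ext[OF xy(1)] ext[OF xy(2)], of s t] by (simp only: mid)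
    qed (use xy insert.prems upd in auto)
  qed measurable
  then show ?case
    using insert.hyps insert.prems(1-3) by (simp add: product_nn_integral_insert)
qed

text \<open>Lebesgue measure is a product of copies of one-dimensional Lebesgue measure along an orthonormal
basis, so the inequality for product measures is the inequality in Euclidean space.\<close>

theorem prekopa_leindler:
  fixes f g h :: "'a::euclidean_space \<Rightarrow> ennreal"
  assumes [measurable]: "f \<in> borel_measurable borel" "g \<in> borel_measurable borel" "h \<in> borel_measurable borel"
    and mid: "\<And>x y. f x * g y \<le> (h ((1/2) *\<^sub>R (x + y)))\<^sup>2"
  shows "(\<integral>\<^sup>+x. f x \<partial>lborel) * (\<integral>\<^sup>+x. g x \<partial>lborel) \<le> (\<integral>\<^sup>+x. h x \<partial>lborel)\<^sup>2"
proof -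
  let ?e = "\<lambda>u. \<Sum>b\<in>Basis. u b *\<^sub>R b :: 'a"
  have [measurable]: "?e \<in> measurable (\<Pi>\<^sub>M b\<in>Basis. lborel) borel" by measurable
  have coords: "(\<integral>\<^sup>+x. F x \<partial>lborel) = (\<integral>\<^sup>+u. F (?e u) \<partial>(\<Pi>\<^sub>M b\<in>Basis. lborel))"
    if [measurable]: "F \<in> borel_measurable borel" for F :: "'a \<Rightarrow> ennreal"
    by (subst lborel_eq) (simp add: nn_integral_distr)
  have "(\<integral>\<^sup>+u. f (?e u) \<partial>(\<Pi>\<^sub>M b\<in>Basis. lborel)) * (\<integral>\<^sup>+u. g (?e u) \<partial>(\<Pi>\<^sub>M b\<in>Basis. lborel))
      \<le> (\<integral>\<^sup>+u. h (?e u) \<partial>(\<Pi>\<^sub>M b\<in>Basis. lborel))\<^sup>2"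
  proof (rule prekopa_leindler_PiM)
    fix u v :: "'a \<Rightarrow> real"
    have "(1/2) *\<^sub>R (?e u + ?e v) = ?e (\<lambda>b\<in>Basis. (u b + v b) / 2)"
      by (simp add: scaleR_sum_right sum.distrib[symmetric] scaleR_add_left[symmetric])
    then show "f (?e u) * g (?e v) \<le> (h (?e (\<lambda>b\<in>Basis. (u b + v b) / 2)))\<^sup>2"
      using mid[of "?e u" "?e v"] by simp
  qed (simp, measurable)
  then show ?thesis by (simp add: coords)
qed

corollary brunn_minkowski_midpoint:
  fixes A B C :: "'a::euclidean_space set"
  assumes [measurable]: "A \<in> sets borel" "B \<in> sets borel" "C \<in> sets borel"
    and sub: "\<And>x y. x \<in> A \<Longrightarrow> y \<in> B \<Longrightarrow> (1/2) *\<^sub>R (x + y) \<in> C"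
  shows "emeasure lborel A * emeasure lborel B \<le> (emeasure lborel C)\<^sup>2"
proof -
  have "(\<integral>\<^sup>+x. indicator A x \<partial>lborel) * (\<integral>\<^sup>+x. indicator B x \<partial>lborel) \<le> (\<integral>\<^sup>+x. indicator C x \<partial>lborel)\<^sup>2"
    by (rule prekopa_leindler) (auto simp: indicator_def sub power2_eq_square)
  then show ?thesis by simp
qed

corollary brunn_minkowski_midpoint_compact:
  fixes A B C :: "'a::euclidean_space set"
  assumes "compact A" "compact B" "compact C"
    and "\<And>x y. x \<in> A \<Longrightarrow> y \<in> B \<Longrightarrow> (1/2) *\<^sub>R (x + y) \<in> C"
  shows "measure lebesgue A * measure lebesgue B \<le> (measure lebesgue C)\<^sup>2"
proof -
  have "emeasure lebesgue A * emeasure lebesgue B \<le> (emeasure lebesgue C)\<^sup>2"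
    using brunn_minkowski_midpoint[of A B C] assms by (simp add: borel_compact)
  then show ?thesis
    using assms(1-3)[THEN lmeasurable_compact]
    by (simp add: emeasure_eq_measure2 ennreal_power flip: ennreal_mult)
qed

section \<open>Parallel bodies and surface area\<close>

text \<open>The set whose volume the definition of the surface area differentiates at 0.\<close>

definition parallel_body :: "'a::real_normed_vector set \<Rightarrow> real \<Rightarrow> 'a set" where
  "parallel_body K e = {x + y | x y. x \<in> K \<and> y \<in> cball 0 e}"

lemma compact_parallel_body:
  fixes K :: "'a::euclidean_space set"
  shows "compact K \<Longrightarrow> compact (parallel_body K e)"
  unfolding parallel_body_def by (intro compact_sums compact_cball)

lemma convex_parallel_body: "convex K \<Longrightarrow> convex (parallel_body K e)"
proof -
  assume "convex K"
  moreover have "parallel_body K e = (\<Union>x\<in>K. \<Union>y\<in>cball 0 e. {x + y})"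
    unfolding parallel_body_def by blast
  ultimately show ?thesis using convex_sums[OF _ convex_cball] by metis
qed

lemma parallel_body_mono: "K \<subseteq> L \<Longrightarrow> s \<le> t \<Longrightarrow> parallel_body K s \<subseteq> parallel_body L t"
  by (force simp: parallel_body_def)

lemma parallel_body_0 [simp]: "parallel_body K 0 = K"
  by (auto simp: parallel_body_def)

lemma subset_parallel_body: "0 \<le> e \<Longrightarrow> K \<subseteq> parallel_body K e"
  using parallel_body_mono[of K K 0 e] by simp

lemma parallel_body_add:
  assumes "0 \<le> s" "0 \<le> t"
  shows "parallel_body K (s + t) \<subseteq> parallel_body (parallel_body K s) t"
proof
  fix z assume "z \<in> parallel_body K (s + t)"
  then obtain x y where z: "z = x + y" "x \<in> K" "norm y \<le> s + t"
    by (auto simp: parallel_body_def)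
  show "z \<in> parallel_body (parallel_body K s) t"
  proof (cases "s + t = 0")
    case True
    then show ?thesis using z assms by (auto simp: add_nonneg_eq_0_iff)
  next
    case False
    have "y = (s / (s + t)) *\<^sub>R y + (t / (s + t)) *\<^sub>R y"
      using False by (simp add: scaleR_add_left[symmetric] add_divide_distrib[symmetric])
    then have "z = (x + (s / (s + t)) *\<^sub>R y) + (t / (s + t)) *\<^sub>R y" using z by (simp add: add.assoc)
    moreover have "norm ((u / (s + t)) *\<^sub>R y) \<le> u" if "0 \<le> u" for u
      using z(3) that assms False mult_left_mono[of "norm y" "s + t" u] by (simp add: divide_le_eq)
    ultimately show ?thesis
      unfolding parallel_body_def using z(2) assms by fastforce
  qed
qed

lemma measure_compact_mono:
  fixes A B :: "'a::euclidean_space set"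
  shows "compact A \<Longrightarrow> compact B \<Longrightarrow> A \<subseteq> B \<Longrightarrow> measure lebesgue A \<le> measure lebesgue B"
  by (intro measure_mono_fmeasurable) (auto simp: lmeasurable_compact fmeasurableD)

text \<open>A ball of radius \<open>r\<close> about \<open>a\<close> inside \<open>K\<close> gives \<open>B \<subseteq> (K - a) / r\<close>, so
\<open>K + e B \<subseteq> K + (e / r) (K - a)\<close>, which by convexity is a translate of \<open>(1 + e / r) K\<close>.\<close>

lemma measure_parallel_body_le:
  fixes K :: "'a::euclidean_space set"
  assumes K: "compact K" "convex K" and ball: "cball a r \<subseteq> K" and r: "r > 0" and e: "e \<ge> 0"
  shows "measure lebesgue (parallel_body K e) \<le> (1 + e / r) ^ DIM('a) * measure lebesgue K"
proof -
  define T where "T x = (1 + e / r) *\<^sub>R x + - ((e / r) *\<^sub>R a)" for x :: 'a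
  have "parallel_body K e \<subseteq> T ` K"
  proof
    fix z assume "z \<in> parallel_body K e"
    then obtain x y where z: "z = x + y" "x \<in> K" "norm y \<le> e" by (auto simp: parallel_body_def)
    define w where "w = a + (r / e) *\<^sub>R y"
    have "norm ((r / e) *\<^sub>R y) \<le> r" using z(3) r e by (cases "e = 0") (auto simp: field_simps)
    then have w: "w \<in> K" using ball by (auto simp: w_def dist_norm)
    have y: "y = (e / r) *\<^sub>R (w - a)" using z(3) r e by (cases "e = 0") (auto simp: w_def)
    define v where "v = (1 / (1 + e / r)) *\<^sub>R x + ((e / r) / (1 + e / r)) *\<^sub>R w"
    have p: "1 + e / r > 0" using r e by (simp add: add_pos_nonneg)
    have "1 / (1 + e / r) + (e / r) / (1 + e / r) = 1"
      using p by (simp only: add_divide_distrib[symmetric]) simp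
    then have "v \<in> K"
      unfolding v_def using p r e by (intro convexD[OF K(2) z(2) w]) auto
    moreover have "T v = z"
      using p by (simp add: T_def v_def z(1) scaleR_add_right) (simp add: y scaleR_diff_right)
    ultimately show "z \<in> T ` K" by blast
  qed
  moreover have "compact (T ` K)"
    unfolding T_def by (intro compact_continuous_image continuous_intros K)
  ultimately have "measure lebesgue (parallel_body K e) \<le> measure lebesgue (T ` K)"
    by (intro measure_compact_mono compact_parallel_body K)
  also have "\<dots> = (1 + e / r) ^ DIM('a) * measure lebesgue K"
    unfolding T_def using measure_lebesgue_affine[of "1 + e / r" "- ((e / r) *\<^sub>R a)" K] r e by simp
  finally show ?thesis .
qed

text \<open>Reflect in a point where the minimum is attained so that one of the two mirror points is an end point of
the interval: there \<open>f\<close> is nonnegative, at the other one it is at least the minimum.\<close>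

lemma midpoint_concave_nonneg:
  fixes f :: "real \<Rightarrow> real"
  assumes cont: "continuous_on {a..b} f"
    and mid: "\<And>s t. s \<in> {a..b} \<Longrightarrow> t \<in> {a..b} \<Longrightarrow> f s + f t \<le> 2 * f ((s + t) / 2)"
    and ends: "0 \<le> f a" "0 \<le> f b" and x: "x \<in> {a..b}"
  shows "0 \<le> f x"
proof -
  obtain c where c: "c \<in> {a..b}" "\<And>y. y \<in> {a..b} \<Longrightarrow> f c \<le> f y"
    using continuous_attains_inf[OF compact_Icc _ cont] x by auto
  define d where "d = min (c - a) (b - c)"
  have in_ab: "c - d \<in> {a..b}" "c + d \<in> {a..b}" using c(1) by (auto simp: d_def)
  have "f (c - d) + f (c + d) \<le> 2 * f c" using mid[OF in_ab] by simp
  moreover have "f (c - d) \<ge> 0 \<or> f (c + d) \<ge> 0" using ends by (auto simp: d_def min_def)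
  ultimately have "0 \<le> f c" using c(2)[OF in_ab(1)] c(2)[OF in_ab(2)] by linarith
  then show ?thesis using c(2)[OF x] by simp
qed

lemma decreasing_bounded_tendsto_at_right:
  fixes g :: "real \<Rightarrow> real"
  assumes dec: "\<And>s t. 0 < s \<Longrightarrow> s \<le> t \<Longrightarrow> g t \<le> g s" and bd: "\<And>s. 0 < s \<Longrightarrow> g s \<le> B"
  shows "\<exists>l. (g \<longlongrightarrow> l) (at_right 0)"
proof
  let ?l = "SUP s\<in>{0<..}. g s"
  have bdd: "bdd_above (g ` {0<..})" using bd by (auto intro!: bdd_aboveI2[of _ _ B])
  show "(g \<longlongrightarrow> ?l) (at_right 0)"
  proof (rule order_tendstoI)
    fix y assume "y < ?l"
    then obtain t where t: "0 < t" "y < g t" using less_cSUP_iff[OF _ bdd] by auto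
    show "\<forall>\<^sub>F s in at_right 0. y < g s"
      using eventually_at_right_less[of 0] eventually_at_rightI[of 0 t "\<lambda>s. s < t" ] t(1)
      by (auto elim!: eventually_elim2 intro: less_le_trans[OF t(2) dec])
  next
    fix y assume y: "?l < y"
    show "\<forall>\<^sub>F s in at_right 0. g s < y"
      using eventually_at_right_less[of 0]
      by eventually_elim (use y cSUP_upper[OF _ bdd] in force)
  qed
qed

lemma convex_body_measure_pos:
  assumes "convex_body K"
  shows "0 < measure lebesgue K"
proof -
  obtain a r where r: "r > 0" and ball: "cball a r \<subseteq> K"
    using assms by (auto simp: convex_body_def) (meson mem_interior_cball)
  have "measure lebesgue (cball a r) \<le> measure lebesgue K"
    using assms by (intro measure_compact_mono ball) (auto simp: convex_body_def)
  moreover have "0 < measure lebesgue (cball a r)"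
    using content_cball_pos[OF r] by simp
  ultimately show ?thesis by linarith
qed

text \<open>\<open>Lim\<close> in the definition of the surface area is meaningful only if the limit exists. Let
\<open>L e = ln |K + e B|\<close>. The Brunn-Minkowski inequality says that \<open>L\<close> is midpoint concave, and
\<open>L\<close> is Lipschitz by the comparison of a parallel body with a dilate. Hence the slopes of \<open>L\<close>
at 0 increase as \<open>e\<close> decreases to 0 and stay bounded, so that \<open>L\<close>, and with it \<open>exp \<circ> L\<close>, has a right
derivative at 0.\<close>

proposition tendsto_surface_area:
  fixes K :: "(real^'n) set"
  assumes "convex_body K"
  shows "((\<lambda>e. (measure lebesgue (parallel_body K e) - measure lebesgue K) / e) \<longlongrightarrow> surface_area K) (at_right 0)"
proof -
  have K: "compact K" "convex K" using assms by (auto simp: convex_body_def)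
  obtain a r where r: "r > 0" and ball: "cball a r \<subseteq> K"
    using assms by (auto simp: convex_body_def) (meson mem_interior_cball)
  let ?n = "DIM(real^'n)"
  define V where "V e = measure lebesgue (parallel_body K e)" for e
  define L where "L e = ln (V e)" for e
  have V0: "0 < V 0" using convex_body_measure_pos[OF assms] by (simp add: V_def)
  have Vmono: "V s \<le> V t" if "s \<le> t" for s t
    unfolding V_def by (intro measure_compact_mono compact_parallel_body K parallel_body_mono that order_refl)
  have Vpos: "0 < V e" if "0 \<le> e" for e using V0 Vmono[OF that] by linarith
  have Lmid: "L s + L t \<le> 2 * L ((s + t) / 2)" if st: "0 \<le> s" "0 \<le> t" for s t
  proof -
    have "V s * V t \<le> (V ((s + t) / 2))\<^sup>2"
      unfolding V_def
    proof (intro brunn_minkowski_midpoint_compact compact_parallel_body K)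
      fix u v assume "u \<in> parallel_body K s" "v \<in> parallel_body K t"
      then obtain x y x' y' where uv: "u = x + y" "v = x' + y'" "x \<in> K" "x' \<in> K"
          "norm y \<le> s" "norm y' \<le> t" by (auto simp: parallel_body_def)
      have "(1/2) *\<^sub>R (u + v) = ((1/2) *\<^sub>R x + (1/2) *\<^sub>R x') + (1/2) *\<^sub>R (y + y')"
        by (simp add: uv algebra_simps)
      moreover have "(1/2) *\<^sub>R x + (1/2) *\<^sub>R x' \<in> K" by (intro convexD[OF K(2)] uv) auto
      moreover have "norm ((1/2) *\<^sub>R (y + y')) \<le> (s + t) / 2"
        using norm_triangle_ineq[of y y'] uv by simp
      ultimately show "(1/2) *\<^sub>R (u + v) \<in> parallel_body K ((s + t) / 2)"
        unfolding parallel_body_def by (intro CollectI) (metis mem_cball_0)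
    qed
    then have "ln (V s * V t) \<le> ln ((V ((s + t) / 2))\<^sup>2)"
      using Vpos st by (intro ln_mono) (auto intro!: mult_pos_pos)
    then show ?thesis using Vpos[of s] Vpos[of t] Vpos[of "(s + t) / 2"] st
      by (simp add: L_def ln_mult ln_realpow)
  qed
  have Lmono: "L s \<le> L t" if "0 \<le> s" "s \<le> t" for s t
    using Vmono[OF that(2)] Vpos[of s] that by (simp add: L_def)
  have Llip: "L t - L s \<le> ?n / r * (t - s)" if st: "0 \<le> s" "s \<le> t" for s t
  proof -
    have p: "0 < 1 + (t - s) / r" using r st by (simp add: add_pos_nonneg)
    have "V t \<le> measure lebesgue (parallel_body (parallel_body K s) (t - s))"
      unfolding V_def using parallel_body_add[of s "t - s" K] st
      by (intro measure_compact_mono compact_parallel_body K) auto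
    also have "\<dots> \<le> (1 + (t - s) / r) ^ ?n * V s"
      unfolding V_def
    proof (rule measure_parallel_body_le[OF _ _ _ r])
      show "cball a r \<subseteq> parallel_body K s" using ball subset_parallel_body[OF st(1)] by blast
    qed (use st K in \<open>auto intro: compact_parallel_body convex_parallel_body\<close>)
    finally have "L t \<le> ln ((1 + (t - s) / r) ^ ?n * V s)"
      unfolding L_def using Vpos[of t] st by (intro ln_mono) auto
    also have "\<dots> = ?n * ln (1 + (t - s) / r) + L s"
      using p Vpos[of s] st by (simp add: ln_mult ln_realpow L_def)
    also have "\<dots> \<le> ?n * ((t - s) / r) + L s"
      using r st by (intro add_right_mono mult_left_mono ln_add_one_self_le_self) auto
    finally show ?thesis by (simp add: field_simps)
  qed
  have Lcont: "continuous_on {0..b} L" for b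
  proof (rule lipschitz_on_continuous_on)
    show "(?n / r)-lipschitz_on {0..b} L"
    proof (rule lipschitz_onI)
      fix s t assume "s \<in> {0..b}" "t \<in> {0..b}"
      then show "dist (L s) (L t) \<le> ?n / r * dist s t"
        using Llip[of s t] Llip[of t s] Lmono[of s t] Lmono[of t s]
        by (cases "s \<le> t") (auto simp: dist_real_def)
    qed (use r in simp)
  qed
  define g where "g s = (L s - L 0) / s" for s
  have gdec: "g t \<le> g s" if st: "0 < s" "s \<le> t" for s t
  proof -
    \<comment> \<open>Concavity: the graph of L lies above its chord over the interval from 0 to t.\<close>
    have "0 \<le> L s - L 0 - g t * s"
    proof (rule midpoint_concave_nonneg[where f = "\<lambda>u. L u - L 0 - g t * u" and a = 0 and b = t])
      show "continuous_on {0..t} (\<lambda>u. L u - L 0 - g t * u)" by (intro continuous_intros Lcont)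
      show "L u - L 0 - g t * u + (L v - L 0 - g t * v)
          \<le> 2 * (L ((u + v) / 2) - L 0 - g t * ((u + v) / 2))"
        if "u \<in> {0..t}" "v \<in> {0..t}" for u v
        using Lmid[of u v] that by (simp add: algebra_simps add_divide_distrib)
    qed (use st in \<open>auto simp: g_def\<close>)
    then show ?thesis using st by (simp add: g_def field_simps)
  qed
  have gbd: "g s \<le> ?n / r" if "0 < s" for s
    using Llip[of 0 s] that by (simp add: g_def divide_le_eq)
  obtain l where l: "(g \<longlongrightarrow> l) (at_right 0)"
    using decreasing_bounded_tendsto_at_right[of g, OF gdec gbd] by blast
  have "(L has_field_derivative l) (at 0 within {0..})"
    using l by (simp add: has_field_derivative_iff g_def[abs_def] at_within_Ici_at_right)
  then have "((\<lambda>e. exp (L e)) has_field_derivative exp (L 0) * l) (at 0 within {0..})"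
    by (auto intro!: derivative_eq_intros)
  then have "(V has_field_derivative V 0 * l) (at 0 within {0..})"
    by (rule has_field_derivative_transform_within[where d = 1, THEN DERIV_cong])
       (use Vpos in \<open>auto simp: L_def\<close>)
  then have lim: "((\<lambda>e. (V e - V 0) / e) \<longlongrightarrow> V 0 * l) (at_right 0)"
    by (simp add: has_field_derivative_iff at_within_Ici_at_right)
  then have "surface_area K = V 0 * l"
    unfolding surface_area_def V_def parallel_body_def[symmetric]
    by (intro tendsto_Lim) auto
  then show ?thesis using lim by (simp add: V_def)
qed

section \<open>Minkowski's first inequality for a ball\<close>

definition midpoint_sum :: "'a::real_vector set \<Rightarrow> 'a set \<Rightarrow> 'a set" where
  "midpoint_sum A B = {(1/2) *\<^sub>R (x + y) | x y. x \<in> A \<and> y \<in> B}"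

lemma midpoint_sum_eq_image: "midpoint_sum A B = (\<lambda>p. (1/2) *\<^sub>R (fst p + snd p)) ` (A \<times> B)"
  unfolding midpoint_sum_def by force

lemma compact_midpoint_sum:
  fixes A B :: "'a::real_normed_vector set"
  shows "compact A \<Longrightarrow> compact B \<Longrightarrow> compact (midpoint_sum A B)"
  unfolding midpoint_sum_eq_image by (intro compact_continuous_image compact_Times continuous_intros)

lemma measure_midpoint_sum_ge:
  fixes A B :: "'a::euclidean_space set"
  assumes "compact A" "compact B" "0 \<le> m" "m \<le> measure lebesgue A" "m \<le> measure lebesgue B"
  shows "m \<le> measure lebesgue (midpoint_sum A B)"
proof -
  have "m\<^sup>2 \<le> measure lebesgue A * measure lebesgue B"
    unfolding power2_eq_square using assms by (intro mult_mono) auto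
  also have "\<dots> \<le> (measure lebesgue (midpoint_sum A B))\<^sup>2"
    using assms by (intro brunn_minkowski_midpoint_compact compact_midpoint_sum) (auto simp: midpoint_sum_def)
  finally show ?thesis by (rule power2_le_imp_le) simp
qed

text \<open>Repeated midpoints with \<open>K\<close> move \<open>A\<close> towards \<open>K\<close>, and by the Brunn-Minkowski inequality the volume
never drops below that of \<open>K\<close>.\<close>

lemma dyadic_combination_measure_ge:
  fixes K A B :: "'a::euclidean_space set"
  assumes K: "compact K" "convex K" and A: "compact A" "A \<subseteq> B" "measure lebesgue K \<le> measure lebesgue A"
  shows "\<exists>L. compact L \<and> measure lebesgue K \<le> measure lebesgue L \<and>
    L \<subseteq> {(1 - 1/2^k) *\<^sub>R x + (1/2^k) *\<^sub>R y | x y. x \<in> K \<and> y \<in> B}"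
proof (induction k)
  case 0
  show ?case
  proof (cases "K = {}")
    case True
    then show ?thesis by (intro exI[of _ "{}"]) auto
  next
    case False
    then show ?thesis using A by (intro exI[of _ A]) auto
  qed
next
  case (Suc k)
  then obtain L where L: "compact L" "measure lebesgue K \<le> measure lebesgue L"
    "L \<subseteq> {(1 - 1/2^k) *\<^sub>R x + (1/2^k) *\<^sub>R y | x y. x \<in> K \<and> y \<in> B}" by blast
  define t :: real where "t = 1/2^k"
  have t: "0 < t" "t \<le> 1" "1/2^Suc k = t / 2" by (auto simp: t_def)
  have "midpoint_sum K L \<subseteq> {(1 - t/2) *\<^sub>R x + (t/2) *\<^sub>R y | x y. x \<in> K \<and> y \<in> B}"
  proof
    fix z assume "z \<in> midpoint_sum K L"
    then obtain w u where z: "z = (1/2) *\<^sub>R (w + u)" "w \<in> K" "u \<in> L" by (auto simp: midpoint_sum_def)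
    then obtain x y where u: "u = (1 - t) *\<^sub>R x + t *\<^sub>R y" "x \<in> K" "y \<in> B"
      using L(3) by (auto simp: t_def)
    define v where "v = ((1/2) / (1 - t/2)) *\<^sub>R w + (((1 - t)/2) / (1 - t/2)) *\<^sub>R x"
    have "(1/2) / (1 - t/2) + ((1 - t)/2) / (1 - t/2) = 1"
    proof -
      have "1/2 + (1 - t)/2 = 1 - t/2" by (simp add: field_simps)
      then show ?thesis using t by (simp only: add_divide_distrib[symmetric]) simp
    qed
    then have "v \<in> K" unfolding v_def using t by (intro convexD[OF K(2) z(2) u(2)]) auto
    moreover have "(1 - t/2) *\<^sub>R v = (1/2) *\<^sub>R w + ((1 - t)/2) *\<^sub>R x"
    proof -
      have "(1 - t/2) * (q / (1 - t/2)) = q" for q using t by simp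
      then show ?thesis unfolding v_def scaleR_add_right scaleR_scaleR by (simp only:)
    qed
    then have "z = (1 - t/2) *\<^sub>R v + (t/2) *\<^sub>R y"
      by (simp add: z u scaleR_add_right)
    ultimately show "z \<in> {(1 - t/2) *\<^sub>R x + (t/2) *\<^sub>R y | x y. x \<in> K \<and> y \<in> B}" using u(3) by blast
  qed
  moreover have "measure lebesgue K \<le> measure lebesgue (midpoint_sum K L)"
    using K L by (intro measure_midpoint_sum_ge) auto
  ultimately show ?case
    unfolding t(3) using compact_midpoint_sum[OF K(1) L(1)] by blast
qed

text \<open>Minkowski's first inequality, for a set \<open>A\<close> of at least the volume of \<open>K\<close> that is then enlarged to a
ball. With \<open>e = t / (1 - t)\<close>, the set \<open>K + e \<rho> B\<close> is \<open>1 / (1 - t) = 1 + e\<close> times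
\<open>(1 - t) K + t \<rho> B\<close>, which for dyadic \<open>t\<close> has at least the volume of \<open>K\<close>. So
\<open>|K + e \<rho> B| \<ge> (1 + e)^n |K|\<close>, and differentiation at \<open>e = 0\<close> gives the claim.\<close>

proposition surface_area_ge_of_subset_ball:
  fixes K A :: "(real^'n) set"
  assumes K: "convex_body K" and A: "compact A" "A \<subseteq> cball 0 \<rho>" "measure lebesgue K \<le> measure lebesgue A"
    and \<rho>: "\<rho> > 0"
  shows "real CARD('n) * measure lebesgue K \<le> \<rho> * surface_area K"
proof -
  have K': "compact K" "convex K" using K by (auto simp: convex_body_def)
  let ?V = "\<lambda>e. measure lebesgue (parallel_body K e)"
  let ?n = "CARD('n)"
  \<comment> \<open>The exponent starts at 1 since e = t / (1 - t) requires t < 1.\<close>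
  define e :: "nat \<Rightarrow> real" where "e k = (1/2^Suc k) / (1 - 1/2^Suc k)" for k
  have t: "(1::real)/2^Suc k \<le> 1/2" for k by (simp add: field_simps)
  have e0: "0 < e k" for k
  proof -
    have "0 < 1 - 1 / (2::real)^Suc k" using t[of k] by linarith
    then show ?thesis unfolding e_def by (intro divide_pos_pos) auto
  qed
  have "(\<lambda>k. (1/2) ^ Suc k :: real) \<longlonglongrightarrow> 0"
    by (intro LIMSEQ_Suc LIMSEQ_power_zero) simp
  then have "(\<lambda>k. (1/2^Suc k) / (1 - 1/2^Suc k) :: real) \<longlonglongrightarrow> 0 / (1 - 0)"
    by (intro tendsto_intros) (auto simp: power_divide)
  then have "e \<longlonglongrightarrow> 0" by (simp add: e_def[abs_def])
  then have "(\<lambda>k. \<rho> * e k) \<longlonglongrightarrow> 0" by (rule tendsto_mult_right_zero)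
  then have "filterlim (\<lambda>k. \<rho> * e k) (at_right 0) sequentially"
    using e0 \<rho> by (intro tendsto_imp_filterlim_at_right) auto
  from filterlim_compose[OF tendsto_surface_area[OF K] this]
  have lim: "(\<lambda>k. (?V (\<rho> * e k) - measure lebesgue K) / (\<rho> * e k)) \<longlonglongrightarrow> surface_area K" .
  have ge: "?n * measure lebesgue K / \<rho> \<le> (?V (\<rho> * e k) - measure lebesgue K) / (\<rho> * e k)" for k
  proof -
    define t :: real where "t = 1/2^Suc k"
    have t: "0 < t" "t \<le> 1/2" using t[of k] by (auto simp: t_def)
    have ek: "e k = t / (1 - t)" by (simp add: e_def t_def)
    obtain L where L: "compact L" "measure lebesgue K \<le> measure lebesgue L"
      "L \<subseteq> {(1 - t) *\<^sub>R x + t *\<^sub>R y | x y. x \<in> K \<and> y \<in> cball 0 \<rho>}"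
      using dyadic_combination_measure_ge[OF K' A, of "Suc k"] unfolding t_def by blast
    have "L \<subseteq> (*\<^sub>R) (1 - t) ` parallel_body K (\<rho> * e k)"
    proof
      fix z assume "z \<in> L"
      then obtain x y where z: "z = (1 - t) *\<^sub>R x + t *\<^sub>R y" "x \<in> K" "norm y \<le> \<rho>" using L(3) by auto
      have "z = (1 - t) *\<^sub>R (x + e k *\<^sub>R y)" using t by (simp add: z ek scaleR_add_right)
      moreover have "norm (e k *\<^sub>R y) \<le> \<rho> * e k"
        using e0[of k] z(3) by (simp add: mult.commute mult_left_mono)
      then have "x + e k *\<^sub>R y \<in> parallel_body K (\<rho> * e k)"
        using z(2) unfolding parallel_body_def
        by (intro CollectI exI[of _ x] exI[of _ "e k *\<^sub>R y"]) (simp del: norm_scaleR)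
      ultimately show "z \<in> (*\<^sub>R) (1 - t) ` parallel_body K (\<rho> * e k)" by blast
    qed
    then have "measure lebesgue L \<le> measure lebesgue ((*\<^sub>R) (1 - t) ` parallel_body K (\<rho> * e k))"
      by (intro measure_compact_mono L compact_scaling compact_parallel_body K')
    also have "\<dots> = (1 - t) ^ ?n * ?V (\<rho> * e k)"
      using measure_lebesgue_affine[of "1 - t" 0 "parallel_body K (\<rho> * e k)"] t by simp
    finally have le: "measure lebesgue K \<le> (1 - t) ^ ?n * ?V (\<rho> * e k)" using L(2) by simp
    have "(1 + ?n * e k) * measure lebesgue K \<le> (1 + e k) ^ ?n * measure lebesgue K"
      using e0[of k] by (intro mult_right_mono Bernoulli_inequality) auto
    also have "\<dots> \<le> (1 + e k) ^ ?n * ((1 - t) ^ ?n * ?V (\<rho> * e k))"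
      using e0[of k] by (intro mult_left_mono le) auto
    also have "\<dots> = ((1 + e k) * (1 - t)) ^ ?n * ?V (\<rho> * e k)"
      by (simp add: power_mult_distrib)
    also have "(1 + e k) * (1 - t) = 1" using t by (simp add: ek field_simps)
    finally show ?thesis using e0[of k] \<rho> by (simp add: field_simps)
  qed
  have "?n * measure lebesgue K / \<rho> \<le> surface_area K"
    using ge by (intro LIMSEQ_le_const[OF lim]) auto
  then show ?thesis using \<rho> by (simp add: field_simps)
qed

section \<open>Support functions and orthogonal maps\<close>

lemma support_function_upper:
  assumes "compact A" "x \<in> A"
  shows "x \<bullet> y \<le> support_function A y"
proof -
  have "bounded ((\<lambda>x. x \<bullet> y) ` A)"
    by (intro compact_imp_bounded compact_continuous_image continuous_intros assms)
  then show ?thesis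
    unfolding support_function_def using assms(2) by (intro cSUP_upper bounded_imp_bdd_above)
qed

lemma support_function_le:
  assumes "A \<noteq> {}" "\<And>x. x \<in> A \<Longrightarrow> x \<bullet> y \<le> c"
  shows "support_function A y \<le> c"
  unfolding support_function_def using assms by (intro cSUP_least)

lemma support_function_le_of_subset_ball:
  assumes "A \<noteq> {}" "A \<subseteq> cball 0 c" "norm y = 1"
  shows "support_function A y \<le> c"
proof (rule support_function_le[OF assms(1)])
  fix x assume "x \<in> A"
  then show "x \<bullet> y \<le> c" using norm_cauchy_schwarz[of x y] assms by auto
qed

lemma subset_ball_of_support_function_le:
  fixes A :: "(real^'n) set"
  assumes "compact A" "\<And>y. norm y = 1 \<Longrightarrow> support_function A y \<le> c"
  shows "A \<subseteq> cball 0 c"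
proof
  fix x assume x: "x \<in> A"
  define y where "y = (if x = 0 then axis undefined 1 else x /\<^sub>R norm x)"
  have "norm y = 1" by (simp add: y_def)
  moreover have "x \<bullet> y = norm x" by (simp add: y_def dot_square_norm power2_eq_square)
  ultimately have "norm x \<le> c"
    using support_function_upper[OF assms(1) x, of y] assms(2)[of y] by simp
  then show "x \<in> cball 0 c" by simp
qed

lemma support_function_lipschitz:
  assumes "compact A" "A \<noteq> {}" "A \<subseteq> cball 0 c"
  shows "support_function A y \<le> support_function A z + c * norm (y - z)"
proof (rule support_function_le[OF assms(2)])
  fix x assume x: "x \<in> A"
  have "x \<bullet> y = x \<bullet> z + x \<bullet> (y - z)" by (simp add: inner_diff_right)
  also have "x \<bullet> (y - z) \<le> norm x * norm (y - z)" by (rule norm_cauchy_schwarz)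
  also have "\<dots> \<le> c * norm (y - z)" using x assms(3) by (intro mult_right_mono) auto
  finally show "x \<bullet> y \<le> support_function A z + c * norm (y - z)"
    using support_function_upper[OF assms(1) x, of z] by simp
qed

lemma continuous_on_support_function:
  assumes "compact A" "A \<noteq> {}"
  shows "continuous_on UNIV (support_function A)"
proof -
  obtain c where c: "A \<subseteq> cball 0 c" "0 < c"
    using compact_imp_bounded[OF assms(1)] unfolding bounded_pos subset_iff mem_cball_0 by blast
  have "c-lipschitz_on UNIV (support_function A)"
  proof (rule lipschitz_onI)
    fix y z
    show "dist (support_function A y) (support_function A z) \<le> c * dist y z"
      using support_function_lipschitz[OF assms c(1), of y z] support_function_lipschitz[OF assms c(1), of z y]
      by (auto simp: dist_real_def dist_norm norm_minus_commute)
  qed (use c in simp)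
  then show ?thesis by (rule lipschitz_on_continuous_on)
qed

lemma support_function_midpoint_sum:
  assumes A: "compact A" "A \<noteq> {}" and B: "compact B" "B \<noteq> {}"
  shows "support_function (midpoint_sum A B) y = (support_function A y + support_function B y) / 2"
proof (rule antisym)
  show "support_function (midpoint_sum A B) y \<le> (support_function A y + support_function B y) / 2"
  proof (rule support_function_le)
    show "midpoint_sum A B \<noteq> {}" using A B by (auto simp: midpoint_sum_def)
    fix z assume "z \<in> midpoint_sum A B"
    then obtain a b where "z = (1/2) *\<^sub>R (a + b)" "a \<in> A" "b \<in> B" by (auto simp: midpoint_sum_def)
    then show "z \<bullet> y \<le> (support_function A y + support_function B y) / 2"
      using support_function_upper[OF A(1), of a y] support_function_upper[OF B(1), of b y]
      by (simp add: inner_add_left)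
  qed
  have ab: "a \<bullet> y \<le> 2 * support_function (midpoint_sum A B) y - b \<bullet> y" if "a \<in> A" "b \<in> B" for a b
  proof -
    have "(1/2) *\<^sub>R (a + b) \<in> midpoint_sum A B" using that by (auto simp: midpoint_sum_def)
    from support_function_upper[OF compact_midpoint_sum[OF A(1) B(1)] this, of y]
    show ?thesis by (simp add: inner_add_left)
  qed
  have "b \<bullet> y \<le> 2 * support_function (midpoint_sum A B) y - support_function A y" if "b \<in> B" for b
    using support_function_le[OF A(2) ab[OF _ that]] by linarith
  then have "support_function B y \<le> 2 * support_function (midpoint_sum A B) y - support_function A y"
    by (rule support_function_le[OF B(2)])
  then show "(support_function A y + support_function B y) / 2 \<le> support_function (midpoint_sum A B) y"
    by (simp add: field_simps)
qed

lemma support_function_orthogonal_image: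
  assumes "orthogonal_transformation f"
  shows "support_function (f ` A) (f y) = support_function A y"
  using assms by (simp add: support_function_def image_image orthogonal_transformation_def)

lemma compact_orthogonal_image:
  fixes f :: "'a::euclidean_space \<Rightarrow> 'a"
  assumes "orthogonal_transformation f" "compact A"
  shows "compact (f ` A)"
  using assms by (intro compact_continuous_image linear_continuous_on)
    (auto simp: linear_conv_bounded_linear[symmetric] orthogonal_transformation_linear)

lemma measure_orthogonal_image_compact:
  fixes f :: "'a::euclidean_space \<Rightarrow> 'a"
  assumes f: "orthogonal_transformation f" and A: "compact A"
  shows "measure lebesgue (f ` A) = measure lebesgue A"
proof -
  have fb: "f \<in> borel_measurable borel"
    using f by (simp add: borel_measurable_continuous_onI linear_continuous_on
        linear_conv_bounded_linear[symmetric] orthogonal_transformation_linear)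
  have fA: "f ` A \<in> sets borel"
    using compact_orthogonal_image[OF f A] by (rule borel_compact)
  have "emeasure lborel (f ` A) = emeasure (distr lborel borel f) (f ` A)"
    by (simp add: lborel_distr_orthogonal[OF f])
  also have "\<dots> = emeasure lborel (f -` f ` A)"
    using fb fA by (simp add: emeasure_distr)
  also have "f -` f ` A = A"
    by (rule inj_vimage_image_eq[OF orthogonal_transformation_inj[OF f]])
  finally show ?thesis
    using fA borel_compact[OF A] by (simp add: measure_def)
qed

section \<open>Flat boxes\<close>

definition flat_box :: "'n \<Rightarrow> real \<Rightarrow> (real^'n) set" where
  "flat_box i d = {x. \<forall>k. \<bar>x $ k\<bar> \<le> (if k = i then d else 1)}"

lemma flat_box_eq_cbox:
  "flat_box i d = cbox (- (\<chi> k. if k = i then d else 1)) (\<chi> k. if k = i then d else 1)"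
proof -
  have abs: "\<bar>t\<bar> \<le> c \<longleftrightarrow> - c \<le> t \<and> t \<le> c" for t c :: real by linarith
  show ?thesis
    by (simp only: flat_box_def set_eq_iff mem_box_cart mem_Collect_eq abs vector_uminus_component
        vec_lambda_beta simp_thms)
qed

lemma measure_flat_box:
  fixes i :: "'n::finite"
  assumes "0 \<le> d"
  shows "measure lebesgue (flat_box i d) = 2 ^ CARD('n) * d"
proof -
  let ?v = "\<chi> k. if k = i then d else 1"
  have "0 \<in> flat_box i d" using assms by (simp add: flat_box_def)
  then have "cbox (- ?v) ?v \<noteq> {}" unfolding flat_box_eq_cbox by blast
  then have "measure lebesgue (flat_box i d) = (\<Prod>k\<in>UNIV. ?v $ k - (- ?v) $ k)"
    unfolding flat_box_eq_cbox by (simp add: content_cbox_cart)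
  also have "\<dots> = (\<Prod>k\<in>UNIV. 2 * (if k = i then d else 1))"
    by (intro prod.cong) auto
  also have "\<dots> = 2 ^ CARD('n) * d"
    by (simp add: prod.distrib)
  finally show ?thesis .
qed

lemma convex_body_flat_box:
  fixes i :: "'n::finite"
  assumes "0 < d"
  shows "convex_body (flat_box i d)"
proof -
  have "0 \<in> box (- (\<chi> k. if k = i then d else 1)) (\<chi> k. if k = i then d else 1)"
    using assms by (simp add: mem_box_cart)
  then show ?thesis
    unfolding convex_body_def flat_box_eq_cbox by (auto simp: interior_cbox compact_cbox convex_box)
qed

text \<open>Thickening the box by \<open>e\<close> in the flat direction alone already adds volume \<open>2^n e\<close>: the
two large faces contribute this much to the surface area, whatever the thickness.\<close>

lemma surface_area_flat_box_ge:
  fixes i :: "'n::finite"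
  assumes d: "0 < d"
  shows "2 ^ CARD('n) \<le> surface_area (flat_box i d)"
proof (rule tendsto_lowerbound[OF tendsto_surface_area[OF convex_body_flat_box[OF d]]])
  show "\<forall>\<^sub>F e in at_right 0. 2 ^ CARD('n) \<le>
    (measure lebesgue (parallel_body (flat_box i d) e) - measure lebesgue (flat_box i d)) / e"
    using eventually_at_right_less[of 0]
  proof eventually_elim
    fix e :: real assume e: "0 < e"
    have "flat_box i (d + e) \<subseteq> parallel_body (flat_box i d) e"
    proof
      fix x assume x: "x \<in> flat_box i (d + e)"
      define s where "s = max (- e) (min e (x $ i))"
      have "norm (s *\<^sub>R axis i (1::real)) \<le> e" using e by (simp add: s_def)
      moreover have "x - s *\<^sub>R axis i 1 \<in> flat_box i d"
        unfolding flat_box_def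
      proof (intro CollectI allI)
        fix k
        have "\<bar>x $ k\<bar> \<le> (if k = i then d + e else 1)" using x by (simp add: flat_box_def)
        then show "\<bar>(x - s *\<^sub>R axis i 1) $ k\<bar> \<le> (if k = i then d else 1)"
          using d e by (auto simp: axis_def s_def split: if_splits)
      qed
      moreover have "x = (x - s *\<^sub>R axis i 1) + s *\<^sub>R axis i 1" by simp
      ultimately show "x \<in> parallel_body (flat_box i d) e"
        unfolding parallel_body_def by (intro CollectI) (metis mem_cball_0)
    qed
    then have "measure lebesgue (flat_box i (d + e)) \<le> measure lebesgue (parallel_body (flat_box i d) e)"
      by (intro measure_compact_mono compact_parallel_body) (auto simp: flat_box_eq_cbox compact_cbox)
    then show "2 ^ CARD('n) \<le>
      (measure lebesgue (parallel_body (flat_box i d) e) - measure lebesgue (flat_box i d)) / e"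
      using d e by (simp add: measure_flat_box field_simps)
  qed
qed simp

section \<open>Mean width\<close>

context
  assumes dim: "CARD('n::finite) \<ge> 2"
begin

interpretation sphere_prob: prob_space "sphere_prob :: (real^'n) measure"
  using sphere_prob_rotation_invariant[OF dim] by (simp add: rotation_invariant_prob_def)

lemma sets_sphere_prob: "sets (sphere_prob :: (real^'n) measure) = sets (restrict_space borel (sphere 0 1))"
  using sphere_prob_rotation_invariant[OF dim] by (simp add: rotation_invariant_prob_def)

lemma space_sphere_prob: "space (sphere_prob :: (real^'n) measure) = sphere 0 1"
  using sets_eq_imp_space_eq[OF sets_sphere_prob] by (simp add: space_restrict_space)

lemma integrable_sphere_prob:
  fixes f :: "real^'n \<Rightarrow> real"
  assumes "continuous_on UNIV f"
  shows "integrable sphere_prob f"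
proof -
  have "f \<in> borel_measurable borel" by (rule borel_measurable_continuous_onI[OF assms])
  then have "f \<in> borel_measurable (restrict_space borel (sphere 0 1))"
    by (rule measurable_restrict_space1)
  then have m: "f \<in> borel_measurable sphere_prob"
    using measurable_cong_sets[OF sets_sphere_prob refl] by blast
  have "bounded (f ` sphere 0 1)"
    by (intro compact_imp_bounded compact_continuous_image continuous_on_subset[OF assms]) auto
  then obtain B where "\<forall>x\<in>sphere 0 1. norm (f x) \<le> B" unfolding bounded_iff by auto
  then show ?thesis
    by (intro sphere_prob.integrable_const_bound[of _ B] m AE_I2) (auto simp: space_sphere_prob)
qed

lemma integrable_support_function:
  fixes A :: "(real^'n) set"
  shows "compact A \<Longrightarrow> A \<noteq> {} \<Longrightarrow> integrable sphere_prob (support_function A)"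
  by (intro integrable_sphere_prob continuous_on_support_function)

lemma mean_width_midpoint_sum:
  fixes A B :: "(real^'n) set"
  assumes "compact A" "A \<noteq> {}" "compact B" "B \<noteq> {}"
  shows "mean_width (midpoint_sum A B) = (mean_width A + mean_width B) / 2"
proof -
  have "support_function (midpoint_sum A B) = (\<lambda>\<xi>. (support_function A \<xi> + support_function B \<xi>) / 2)"
    using support_function_midpoint_sum[OF assms] by blast
  then show ?thesis
    using assms by (simp add: mean_width_def integrable_support_function)
qed

lemma mean_width_orthogonal_image:
  fixes A :: "(real^'n) set" and f :: "real^'n \<Rightarrow> real^'n"
  assumes A: "compact A" "A \<noteq> {}" and f: "orthogonal_transformation f"
  shows "mean_width (f ` A) = mean_width A"
proof -
  have lin: "linear f" using f by (simp add: orthogonal_transformation_linear)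
  have Q: "(*v) (matrix f) = f" using lin by (auto simp: matrix_works fun_eq_iff)
  have inv: "distr sphere_prob sphere_prob f = sphere_prob"
    using sphere_prob_orthogonal_invariant[OF dim, of "matrix f"] f
    by (simp add: Q orthogonal_transformation_matrix)
  have "f \<in> borel_measurable borel"
    using lin by (simp add: borel_measurable_continuous_onI linear_continuous_on linear_conv_bounded_linear)
  then have "f \<in> measurable (restrict_space borel (sphere 0 1)) (restrict_space borel (sphere 0 1))"
    using f by (intro measurable_restrict_space3) (auto simp: orthogonal_transformation_norm)
  then have fm: "f \<in> measurable sphere_prob sphere_prob"
    using measurable_cong_sets[OF sets_sphere_prob sets_sphere_prob] by blast
  have "mean_width (f ` A) = (\<integral>\<xi>. support_function (f ` A) \<xi> \<partial>distr sphere_prob sphere_prob f)"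
    by (simp add: mean_width_def inv)
  also have "\<dots> = (\<integral>\<xi>. support_function (f ` A) (f \<xi>) \<partial>sphere_prob)"
    using compact_orthogonal_image[OF f A(1)] A(2)
    by (intro integral_distr fm borel_measurable_integrable integrable_support_function) auto
  finally show ?thesis by (simp add: mean_width_def support_function_orthogonal_image[OF f])
qed

text \<open>A function cannot exceed its average everywhere.\<close>

lemma ex_support_function_le_mean_width:
  fixes A :: "(real^'n) set"
  assumes "compact A" "A \<noteq> {}"
  shows "\<exists>\<xi>. norm \<xi> = 1 \<and> support_function A \<xi> \<le> mean_width A"
proof (rule ccontr)
  assume "\<not> ?thesis"
  then have "AE \<xi> in sphere_prob. mean_width A < support_function A \<xi>"
    by (intro AE_I2) (auto simp: space_sphere_prob not_le)
  from sphere_prob.expectation_greater[OF integrable_support_function[OF assms] this]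
  show False by (simp add: mean_width_def)
qed

section \<open>Rounding a set by averaging rotated copies\<close>

text \<open>The sets that can be reached from a compact set of volume \<open>m\<close> and mean width \<open>w\<close> by orthogonal maps and
midpoint sums all belong to this class; the class itself is easier to handle than the process. The
radius \<open>c\<close> is the quantity that the averaging argument decreases. As \<open>A \<subseteq> cball 0 c\<close> says that the
support function is at most \<open>c\<close> on the unit sphere, \<open>c\<close> bounds its maximum and is a Lipschitz
constant for it at the same time.\<close>

definition competitors :: "real \<Rightarrow> real \<Rightarrow> real \<Rightarrow> (real^'n) set set" where
  "competitors m w c = {A. compact A \<and> A \<noteq> {} \<and> A \<subseteq> cball 0 c \<and> m \<le> measure lebesgue A \<and> mean_width A = w}"

lemma competitors_orthogonal_image:
  fixes A :: "(real^'n) set" and f :: "real^'n \<Rightarrow> real^'n"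
  assumes "A \<in> competitors m w c" "orthogonal_transformation f"
  shows "f ` A \<in> competitors m w c"
proof -
  have "measure lebesgue (f ` A) = measure lebesgue A"
    using assms by (intro measure_orthogonal_image_compact) (auto simp: competitors_def)
  then show ?thesis
    using assms by (auto simp: competitors_def compact_orthogonal_image mean_width_orthogonal_image
        subset_iff orthogonal_transformation_norm)
qed

lemma competitors_midpoint_sum:
  fixes A B :: "(real^'n) set"
  assumes "A \<in> competitors m w c" "B \<in> competitors m w c" "0 \<le> m"
  shows "midpoint_sum A B \<in> competitors m w c"
proof -
  have A: "compact A" "A \<noteq> {}" "mean_width A = w" "m \<le> measure lebesgue A" "A \<subseteq> cball 0 c"
    and B: "compact B" "B \<noteq> {}" "mean_width B = w" "m \<le> measure lebesgue B" "B \<subseteq> cball 0 c"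
    using assms(1,2) by (simp_all add: competitors_def)
  have "norm ((1/2) *\<^sub>R (x + y)) \<le> c" if "norm x \<le> c" "norm y \<le> c" for x y :: "real^'n"
    using norm_triangle_ineq[of x y] that by simp
  then have "midpoint_sum A B \<subseteq> cball 0 c"
    using A(5) B(5) by (fastforce simp: midpoint_sum_def)
  moreover have "midpoint_sum A B \<noteq> {}" using A(2) B(2) by (auto simp: midpoint_sum_def)
  moreover have "mean_width (midpoint_sum A B) = w"
    by (simp add: mean_width_midpoint_sum A(1-3) B(1-3))
  ultimately show ?thesis
    using A B assms(3) by (simp add: competitors_def compact_midpoint_sum measure_midpoint_sum_ge)
qed

text \<open>The number of sets is a power of two because the average is an iterated midpoint.\<close>

lemma competitors_average:
  fixes B :: "nat \<Rightarrow> (real^'n) set" and k :: nat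
  assumes "0 \<le> m" "\<And>i. i < 2^k \<Longrightarrow> B i \<in> competitors m w c"
  shows "\<exists>C\<in>competitors m w c. \<forall>\<xi>. support_function C \<xi> = (\<Sum>i<2^k. support_function (B i) \<xi>) / 2^k"
  using assms(2)
proof (induction k arbitrary: B)
  case 0
  then show ?case by (intro bexI[of _ "B 0"]) auto
next
  case (Suc k)
  obtain C where C: "C \<in> competitors m w c"
      "\<And>\<xi>. support_function C \<xi> = (\<Sum>i<2^k. support_function (B i) \<xi>) / 2^k"
    using Suc.IH[of B] Suc.prems by (metis less_SucI mult_2 power_Suc trans_less_add1)
  obtain D where D: "D \<in> competitors m w c"
      "\<And>\<xi>. support_function D \<xi> = (\<Sum>i<2^k. support_function (B (2^k + i)) \<xi>) / 2^k"
    using Suc.IH[of "\<lambda>i. B (2^k + i)"] Suc.prems by (auto simp: mult_2)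
  have split: "(\<Sum>i<p + q. g i) = (\<Sum>i<p. g i) + (\<Sum>i<q. g (p + i))" for p q :: nat and g :: "nat \<Rightarrow> real"
    by (induction q) auto
  have "support_function (midpoint_sum C D) \<xi> = (\<Sum>i<2^Suc k. support_function (B i) \<xi>) / 2^Suc k" for \<xi>
  proof -
    have "support_function (midpoint_sum C D) \<xi> = (support_function C \<xi> + support_function D \<xi>) / 2"
      using C(1) D(1) by (intro support_function_midpoint_sum) (auto simp: competitors_def)
    moreover have "(\<Sum>i<2^Suc k. support_function (B i) \<xi>)
        = (\<Sum>i<2^k. support_function (B i) \<xi>) + (\<Sum>i<2^k. support_function (B (2^k + i)) \<xi>)"
      using split[of "\<lambda>i. support_function (B i) \<xi>" "2^k" "2^k"] by (simp only: power_Suc mult_2)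
    ultimately show ?thesis by (simp add: C(2) D(2) add_divide_distrib)
  qed
  then show ?case using competitors_midpoint_sum[OF C(1) D(1) assms(1)] by blast
qed

text \<open>The net is padded to an infinite sequence so that its relevant part can be taken to have \<open>2^k\<close>
entries, the number that an iterated midpoint can average.\<close>

lemma sphere_finite_net:
  assumes "0 < e"
  shows "\<exists>k x. (\<forall>i. x i \<in> sphere 0 1) \<and> (\<forall>\<xi>\<in>sphere 0 1. \<exists>i<(2::nat)^k. dist (x i) (\<xi>::real^'n) < e)"
proof -
  obtain D where D: "finite D" "D \<subseteq> sphere (0::real^'n) 1" "sphere 0 1 \<subseteq> (\<Union>x\<in>D. ball x e)"
    using compactE_image[OF compact_sphere, of "sphere (0::real^'n) 1" "\<lambda>x. ball x e"] \<open>0 < e\<close>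
    by (metis UN_I centre_in_ball open_ball subsetI)
  obtain xs where xs: "set xs = D" using finite_list[OF D(1)] by blast
  define x where "x i = (if i < length xs then xs ! i else axis undefined 1)" for i
  have "x i \<in> sphere 0 1" for i
    using D(2) xs nth_mem[of i xs] by (cases "i < length xs") (auto simp: x_def subset_iff)
  moreover have "\<exists>i<(2::nat)^length xs. dist (x i) \<xi> < e" if "\<xi> \<in> sphere 0 1" for \<xi>
  proof -
    obtain y where "y \<in> D" "dist y \<xi> < e" using D(3) \<open>\<xi> \<in> sphere 0 1\<close> by auto
    then obtain i where "i < length xs" "dist (xs ! i) \<xi> < e" using xs by (metis in_set_conv_nth)
    then show ?thesis
      using less_trans[OF _ less_exp] by (intro exI[of _ i]) (auto simp: x_def)
  qed
  ultimately show ?thesis by blast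
qed

text \<open>If \<open>c\<close> exceeds the mean width by at least \<open>d\<close>, some point \<open>\<xi>0\<close> has support value at most \<open>c - d\<close>. Rotate
copies of \<open>A\<close> so that this point goes to each point of a fine net of the sphere, and average. Every
direction is close to the net, so in every direction one of the copies is below the bound \<open>c\<close> by
\<open>d / 2\<close>, and for a net of \<open>2^k\<close> points the average is below it by \<open>d / 2 / 2^k\<close>. The fineness of the
net depends only on \<open>d\<close> and on the bound \<open>R\<close> for the Lipschitz constants, so the gain is the same for
all \<open>A\<close>; this is what allows the step to be iterated.\<close>

lemma competitors_shrink:
  assumes m: "0 \<le> m" and d: "0 < d" and R: "0 < R"
  shows "\<exists>\<eta>>0. \<forall>c\<le>R. competitors m w c \<noteq> ({} :: (real^'n) set set) \<longrightarrow> w + d \<le> c \<longrightarrow>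
    competitors m w (c - \<eta>) \<noteq> ({} :: (real^'n) set set)"
proof -
  obtain k x where x: "\<And>i. x i \<in> sphere (0::real^'n) 1"
    and net: "\<And>\<xi>. \<xi> \<in> sphere 0 1 \<Longrightarrow> \<exists>i<(2::nat)^k. dist (x i) \<xi> < d / (2 * R)"
    using sphere_finite_net[of "d / (2 * R)"] d R by (metis divide_pos_pos mult_pos_pos zero_less_numeral)
  have step: "competitors m w (c - d / 2 / 2^k) \<noteq> ({} :: (real^'n) set set)"
    if c: "c \<le> R" and A: "A \<in> competitors m w c" and wc: "w + d \<le> c" for c and A :: "(real^'n) set"
  proof -
    have A': "compact A" "A \<noteq> {}" "mean_width A = w" using A by (auto simp: competitors_def)
    obtain \<xi>0 where \<xi>0: "norm \<xi>0 = 1" "support_function A \<xi>0 \<le> w"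
      using ex_support_function_le_mean_width[OF A'(1,2)] A'(3) by auto
    have "\<exists>f. orthogonal_transformation f \<and> f \<xi>0 = x i" for i
      using orthogonal_transformation_exists[of \<xi>0 "x i"] \<xi>0 x[of i] by auto
    then obtain f where f: "\<And>i. orthogonal_transformation (f i)" "\<And>i. f i \<xi>0 = x i" by metis
    define B where "B i = f i ` A" for i
    have B: "B i \<in> competitors m w c" for i
      unfolding B_def by (rule competitors_orthogonal_image[OF A f(1)])
    have B': "compact (B i)" "B i \<noteq> {}" "B i \<subseteq> cball 0 c" for i
      using B[of i] by (auto simp: competitors_def)
    obtain C where C: "C \<in> competitors m w c"
      "\<And>\<xi>. support_function C \<xi> = (\<Sum>i<2^k. support_function (B i) \<xi>) / 2^k"
      using competitors_average[OF m, of k B w c] B by blast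
    have "support_function C \<xi> \<le> c - d / 2 / 2^k" if \<xi>: "norm \<xi> = 1" for \<xi>
    proof -
      obtain j where j: "j < 2^k" "dist (x j) \<xi> < d / (2 * R)" using net[of \<xi>] \<xi> by auto
      have "support_function (B j) \<xi> \<le> support_function (B j) (x j) + R * norm (\<xi> - x j)"
        using B'[of j] c by (intro support_function_lipschitz) auto
      also have "support_function (B j) (x j) = support_function A \<xi>0"
        unfolding B_def f(2)[symmetric] by (rule support_function_orthogonal_image[OF f(1)])
      also have "\<dots> \<le> c - d" using \<xi>0(2) wc by simp
      also have "R * norm (\<xi> - x j) \<le> R * (d / (2 * R))"
        using j(2) R by (intro mult_left_mono) (auto simp: dist_norm norm_minus_commute)
      also have "\<dots> = d / 2" using R by simp
      finally have hj: "support_function (B j) \<xi> \<le> c - d / 2" by simp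
      have "(\<Sum>i<2^k. support_function (B i) \<xi>) \<le> (\<Sum>i<2^k. c - (if i = j then d / 2 else 0))"
        using hj B' support_function_le_of_subset_ball[OF _ _ \<xi>] by (intro sum_mono) auto
      also have "\<dots> = 2^k * c - d / 2" using j(1) by (simp add: sum_subtractf)
      finally show ?thesis unfolding C(2) by (simp add: field_simps)
    qed
    then have "C \<subseteq> cball 0 (c - d / 2 / 2^k)"
      using C(1) by (intro subset_ball_of_support_function_le) (auto simp: competitors_def)
    then show ?thesis using C(1) by (auto simp: competitors_def)
  qed
  show ?thesis
  proof (intro exI conjI allI impI)
    show "0 < d / 2 / 2^k" using d by simp
    fix c assume "c \<le> R" "competitors m w c \<noteq> ({} :: (real^'n) set set)" "w + d \<le> c"
    then show "competitors m w (c - d / 2 / 2^k) \<noteq> ({} :: (real^'n) set set)"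
      using step by blast
  qed
qed

text \<open>A Minkowski average of rotated copies of \<open>K\<close> can be squeezed into a ball whose radius is
arbitrarily close to the mean width. This is the approximate form of averaging over the
rotation group.\<close>

proposition competitor_in_mean_width_ball:
  fixes K :: "(real^'n) set"
  assumes K: "compact K" "K \<noteq> {}" and d: "0 < d"
  shows "\<exists>A :: (real^'n) set. compact A \<and> A \<subseteq> cball 0 (mean_width K + d) \<and> measure lebesgue K \<le> measure lebesgue A"
proof -
  let ?w = "mean_width K" and ?m = "measure lebesgue K"
  obtain R where R: "K \<subseteq> cball 0 R" "0 < R"
    using compact_imp_bounded[OF K(1)] unfolding bounded_pos subset_iff mem_cball_0 by blast
  obtain \<eta> where \<eta>: "\<eta> > 0"
    "\<forall>c\<le>R. competitors ?m ?w c \<noteq> ({} :: (real^'n) set set) \<longrightarrow> ?w + d \<le> c \<longrightarrow>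
      competitors ?m ?w (c - \<eta>) \<noteq> ({} :: (real^'n) set set)"
    using competitors_shrink[of ?m d R ?w, OF _ d R(2)] by auto
  have ex: "\<exists>c. c \<le> R \<and> (c \<le> ?w + d \<or> c \<le> R - real k * \<eta>) \<and>
      competitors ?m ?w c \<noteq> ({} :: (real^'n) set set)" for k
  proof (induction k)
    case 0
    have "K \<in> competitors ?m ?w R" using K R by (auto simp: competitors_def)
    then show ?case by auto
  next
    case (Suc k)
    then obtain c where c: "c \<le> R" "c \<le> ?w + d \<or> c \<le> R - real k * \<eta>"
      "competitors ?m ?w c \<noteq> ({} :: (real^'n) set set)" by blast
    show ?case
    proof (cases "c \<le> ?w + d")
      case True
      then show ?thesis using c by blast
    next
      case False
      then have "competitors ?m ?w (c - \<eta>) \<noteq> ({} :: (real^'n) set set)" using c \<eta>(2) by force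
      then show ?thesis using False c \<eta>(1) by (intro exI[of _ "c - \<eta>"]) (auto simp: algebra_simps)
    qed
  qed
  obtain k :: nat where "(R - (?w + d)) / \<eta> \<le> real k" using real_arch_simple by blast
  then have "R - real k * \<eta> \<le> ?w + d" using \<eta>(1) by (simp add: field_simps)
  then obtain c and A :: "(real^'n) set" where "c \<le> ?w + d" "A \<in> competitors ?m ?w c"
    using ex[of k] by (metis all_not_in_conv order_trans)
  moreover have "cball (0::real^'n) c \<subseteq> cball 0 (?w + d)" using \<open>c \<le> ?w + d\<close> by (rule subset_cball)
  ultimately show ?thesis by (auto simp: competitors_def)
qed

section \<open>The two bounds\<close>

text \<open>A rotation average of \<open>K\<close> has at least the volume of \<open>K\<close> and lies in a ball of radius
\<open>w(K) + d\<close>, so \<open>n |K| \<le> (w(K) + d) S(K)\<close>; let \<open>d\<close> tend to 0.\<close>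

theorem q_ratio_ge_dimension:
  fixes K :: "(real^'n) set"
  assumes K: "convex_body K"
  shows "real CARD('n) \<le> q_ratio K"
proof -
  have pos: "0 < measure lebesgue K" by (rule convex_body_measure_pos[OF K])
  have K': "compact K" "K \<noteq> {}" using K by (auto simp: convex_body_def)
  have step: "real CARD('n) * measure lebesgue K \<le> (mean_width K + d) * surface_area K" if "0 < d" for d
  proof -
    obtain A :: "(real^'n) set" where A: "compact A" "A \<subseteq> cball 0 (mean_width K + d)"
        "measure lebesgue K \<le> measure lebesgue A"
      using competitor_in_mean_width_ball[OF K' \<open>0 < d\<close>] by (elim exE conjE)
    have "0 < mean_width K + d"
    \<comment> \<open>Otherwise the ball is at most a point and cannot contain a set of positive volume.\<close>
    proof (rule ccontr)
      assume "\<not> ?thesis"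
      then have "cball 0 (mean_width K + d) \<subseteq> {0::real^'n}"
        by (auto simp: not_less) (metis norm_le_zero_iff order_trans)
      then have "A \<subseteq> {0}" using A(2) by blast
      then have "measure lebesgue A \<le> measure lebesgue {0::real^'n}"
        by (intro measure_compact_mono A) auto
      then show False using A(3) pos by simp
    qed
    then show ?thesis by (rule surface_area_ge_of_subset_ball[OF K A])
  qed
  have "((\<lambda>d. (mean_width K + d) * surface_area K) \<longlongrightarrow> (mean_width K + 0) * surface_area K) (at_right 0)"
    by (intro tendsto_intros)
  moreover have "\<forall>\<^sub>F d in at_right (0::real). real CARD('n) * measure lebesgue K \<le> (mean_width K + d) * surface_area K"
    using eventually_at_right_less[of 0] by eventually_elim (rule step)
  ultimately have "real CARD('n) * measure lebesgue K \<le> (mean_width K + 0) * surface_area K"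
    by (rule tendsto_lowerbound) simp
  then show ?thesis using pos by (simp add: q_ratio_def field_simps)
qed

text \<open>The \<open>n\<close> averages add up to at least 1, because the \<open>l\<^sup>1\<close> norm is at least 1 on the unit
sphere. It is enough to have one such coordinate, as a box can be flattened in any other direction.\<close>

lemma ex_mean_abs_coordinate_ge:
  "\<exists>j. 1 / real CARD('n) \<le> (\<integral>\<xi>. \<bar>\<xi> $ j\<bar> \<partial>(sphere_prob :: (real^'n) measure))"
proof (rule ccontr)
  let ?I = "\<lambda>j. \<integral>\<xi>. \<bar>\<xi> $ j\<bar> \<partial>(sphere_prob :: (real^'n) measure)"
  assume "\<not> ?thesis"
  then have "(\<Sum>j\<in>UNIV. ?I j) < (\<Sum>j\<in>(UNIV::'n set). 1 / real CARD('n))"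
    by (intro sum_strict_mono) (auto simp: not_le)
  also have "\<dots> = 1" by simp
  also have "1 = (\<integral>\<xi>. (1::real) \<partial>(sphere_prob :: (real^'n) measure))"
    by (simp add: sphere_prob.prob_space)
  also have "\<dots> \<le> (\<integral>\<xi>. (\<Sum>j\<in>UNIV. \<bar>\<xi> $ j\<bar>) \<partial>(sphere_prob :: (real^'n) measure))"
  proof (rule integral_mono_AE)
    show "AE \<xi> in sphere_prob. 1 \<le> (\<Sum>j\<in>UNIV. \<bar>(\<xi>::real^'n) $ j\<bar>)"
    proof (rule AE_I2)
      fix \<xi> :: "real^'n" assume "\<xi> \<in> space sphere_prob"
      then show "1 \<le> (\<Sum>j\<in>UNIV. \<bar>\<xi> $ j\<bar>)"
        using norm_le_l1_cart[of \<xi>] by (simp add: space_sphere_prob)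
    qed
  qed (auto intro!: integrable_sphere_prob continuous_intros)
  also have "\<dots> = (\<Sum>j\<in>UNIV. ?I j)"
    by (intro Bochner_Integration.integral_sum integrable_sphere_prob continuous_intros)
  finally show False by (rule less_irrefl[THEN notE, rotated])
qed

text \<open>The box contains the segment from \<open>- axis j 1\<close> to \<open>axis j 1\<close>, whose support function is
\<open>\<bar>\<xi> $ j\<bar>\<close>.\<close>

lemma mean_width_flat_box_ge:
  fixes i j :: "'n"
  assumes "j \<noteq> i" "0 < d"
  shows "(\<integral>\<xi>. \<bar>\<xi> $ j\<bar> \<partial>sphere_prob) \<le> mean_width (flat_box i d)"
  unfolding mean_width_def
proof (rule integral_mono)
  have cpt: "compact (flat_box i d)" by (simp add: flat_box_eq_cbox compact_cbox)
  have mem: "s *\<^sub>R axis j 1 \<in> flat_box i d" if "\<bar>s\<bar> \<le> 1" for s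
    using that assms by (auto simp: flat_box_def axis_def)
  show "integrable sphere_prob (support_function (flat_box i d))"
    using mem[of 0] by (intro integrable_support_function cpt) auto
  show "integrable sphere_prob (\<lambda>\<xi>. \<bar>\<xi> $ j\<bar>)"
    by (intro integrable_sphere_prob continuous_intros)
  show "\<bar>\<xi> $ j\<bar> \<le> support_function (flat_box i d) \<xi>" for \<xi>
    using support_function_upper[OF cpt mem[of 1], of \<xi>] support_function_upper[OF cpt mem[of "-1"], of \<xi>]
    by (auto simp: inner_axis' abs_le_iff)
qed

text \<open>As the thickness \<open>d\<close> decreases to 0, the mean width and the surface area of a flat box stay bounded
away from 0 and the volume tends to 0. Two different directions are required, one that stays long
and one that is flattened; this is where the dimension must be at least 2.\<close>

theorem ex_symmetric_convex_body_q_ratio_ge: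
  "\<exists>K::(real^'n) set. convex_body K \<and> centrally_symmetric K \<and> B \<le> q_ratio K"
proof -
  obtain j where j: "1 / real CARD('n) \<le> (\<integral>\<xi>. \<bar>\<xi> $ j\<bar> \<partial>(sphere_prob :: (real^'n) measure))"
    using ex_mean_abs_coordinate_ge by blast
  obtain i where i: "j \<noteq> i" using dim ex_card[of 2 "UNIV :: 'n set"] by (metis card_2_iff)
  \<comment> \<open>The thickness for which the lower bound 1 / (n d) for the ratio equals max 1 B.\<close>
  define d where "d = 1 / (real CARD('n) * max 1 B)"
  have d: "0 < d" by (simp add: d_def)
  have "(1 / real CARD('n)) * 2 ^ CARD('n) \<le> mean_width (flat_box i d) * surface_area (flat_box i d)"
    using j mean_width_flat_box_ge[OF i d] surface_area_flat_box_ge[OF d, of i]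
    by (intro mult_mono order_trans[OF _ order_trans[OF j mean_width_flat_box_ge[OF i d]]]) auto
  then have "(1 / real CARD('n)) * 2 ^ CARD('n) / (2 ^ CARD('n) * d) \<le> q_ratio (flat_box i d)"
    unfolding q_ratio_def using d by (simp only: measure_flat_box) (intro divide_right_mono, auto)
  moreover have "(1 / real CARD('n)) * 2 ^ CARD('n) / (2 ^ CARD('n) * d) = max 1 B"
    by (simp add: d_def)
  moreover have "centrally_symmetric (flat_box i d)"
    by (simp add: centrally_symmetric_def flat_box_def)
  ultimately show ?thesis using convex_body_flat_box[OF d, of i] by (intro exI[of _ "flat_box i d"]) simp
qed

end

theorem theorem6p8:
  assumes "CARD('n::finite) \<ge> 2"
  shows "(\<forall>K::(real^'n) set. convex_body K \<longrightarrow> q_ratio K \<ge> real CARD('n)) \<and>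
    (SUP K\<in>{K::(real^'n) set. convex_body K \<and> centrally_symmetric K}. ereal (q_ratio K)) = \<infinity>"
proof (intro conjI allI impI)
  show "q_ratio K \<ge> real CARD('n)" if "convex_body K" for K :: "(real^'n) set"
    by (rule q_ratio_ge_dimension[OF assms that])
  show "(SUP K\<in>{K::(real^'n) set. convex_body K \<and> centrally_symmetric K}. ereal (q_ratio K)) = \<infinity>"
  proof (rule SUP_PInfty)
    fix n :: nat
    show "\<exists>K\<in>{K::(real^'n) set. convex_body K \<and> centrally_symmetric K}. ereal (real n) \<le> ereal (q_ratio K)"
      using ex_symmetric_convex_body_q_ratio_ge[OF assms, of "real n"] by auto
  qed
qed

end
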